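(* For $d\in\mathbb N$ let $\rho_d$ be the value of the semidefinite program $$\rho_d=\sup\int_{\mathcal Q}w_d(q)\,dq$$ over $w_d\in\mathbb R[q]_{2d}$, $\sigma_0,\sigma_{x_1},\dots,\sigma_{x_{m-1}}\in\Sigma[q,x,\tilde y]_{2d}$, $\sigma_1,\dots,\sigma_n\in\Sigma[q,x,\tilde y]_{2d-2}$, $\tau_{\Re,k},\tau_{\Im,k}\in\mathbb R[q,x,\tilde y]_{2d-k}$ ($k=1,\dots,m$), subject to the polynomial identity $$x_m-w_d(q)=\sigma_0+\sum_{j=1}^n\sigma_j(1-q_j^2)+\sum_{k=1}^{m-1}\sigma_{x_k}(x_m-x_k)+\sum_{k=1}^m\tau_{\Re,k}\big((-1)^kp_{m-k}(q)-R_k\big)+\sum_{k=1}^m\tau_{\Im,k}I_k .$$ Let $d_0$ be such that the program is feasible for all $d\ge d_0$, and for $d\ge d_0$ let $w_d$ be a near optimal solution, i.e. feasible with $\int_{\mathcal Q}w_d(q)\,dq\ge\rho_d-\frac1d$. Then $w_d\le a$ on $\mathcal Q$ and $w_d$ converges to the abscissa $a$ in $L^1(\mathcal Q)$ norm.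
   Context: Let $n\ge1$, $\mathcal Q=[-1,1]^n$, $dq$ Lebesgue measure. Let $m\ge1$ and $p(q,s)=\sum_{k=0}^m p_k(q)s^k$ with $p_k\in\mathbb R[q]$, $p_m\equiv1$; the abscissa is $a(q)=\max\{\Re(s):p(q,s)=0\}$. Variables: $x=(x_1,\dots,x_m)\in\mathbb R^m$ and "free imaginary variables" $\tilde y$: if $m$ is even, $\tilde y=(y_2,y_4,\dots,y_m)$ and one sets $y_{2j-1}:=-y_{2j}$; if $m\ge3$ is odd, $\tilde y=(y_2,y_4,\dots,y_{m-1},y_m)$ and one sets $y_{2j-1}:=-y_{2j}$ for $j=1,\dots,\frac{m-3}{2}$ and $y_{m-2}:=-y_{m-1}-y_m$; if $m=1$, $\tilde y=(y_1)$. Put $s_k=x_k+iy_k$, let $e_k(s_1,\dots,s_m)=\sum_{1\le l_1<\dots<l_k\le m}s_{l_1}\cdots s_{l_k}$, and let $R_k,I_k$ be the real polynomials in $(x,\tilde y)$ with $e_k=R_k+iI_k$. $\mathbb R[z]_k$ denotes polynomials of degree at most $k$ and $\Sigma[z]_{2k}$ sums of squares of polynomials of degree at most $2k$ (with $\mathbb R[z]_k=\{0\}$ if $k<0$). *)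

theory Defs
  imports "HOL-Analysis.Analysis"
begin

text \<open>Multivariate real polynomials are represented as polynomial functions
on points z :: nat => real, using only the coordinates z 0, ..., z (N-1).
poly_fun N k f: f is a polynomial in N variables of total degree at most k
(k an integer; for k < 0 only the zero polynomial).\<close>

definition mono_set :: "nat \<Rightarrow> int \<Rightarrow> (nat \<Rightarrow> nat) set" where
  "mono_set N k = {\<alpha>. (\<forall>i\<ge>N. \<alpha> i = 0) \<and> int (sum \<alpha> {..<N}) \<le> k}"

definition poly_fun :: "nat \<Rightarrow> int \<Rightarrow> ((nat \<Rightarrow> real) \<Rightarrow> real) \<Rightarrow> bool" where
  "poly_fun N k f \<longleftrightarrow> (\<exists>c :: (nat \<Rightarrow> nat) \<Rightarrow> real.
      \<forall>z. f z = (\<Sum>\<alpha>\<in>mono_set N k. c \<alpha> * (\<Prod>i<N. z i ^ \<alpha> i)))"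

definition sos :: "nat \<Rightarrow> int \<Rightarrow> ((nat \<Rightarrow> real) \<Rightarrow> real) \<Rightarrow> bool" where
  "sos N k f \<longleftrightarrow> (\<exists>gs. (\<forall>g\<in>set gs. poly_fun N k g) \<and>
      (\<forall>z. f z = (\<Sum>g\<leftarrow>gs. (g z)^2)))"

definition abscissa :: "nat \<Rightarrow> (nat \<Rightarrow> (nat \<Rightarrow> real) \<Rightarrow> real) \<Rightarrow> (nat \<Rightarrow> real) \<Rightarrow> real" where
  "abscissa m p q = Max {Re s | s. (\<Sum>k\<le>m. complex_of_real (p k q) * s ^ k) = 0}"

text \<open>Number of free imaginary variables: ceil(m/2).\<close>
definition nfree :: "nat \<Rightarrow> nat" where
  "nfree m = (m + 1) div 2"

text \<open>yfull m yt k = y_k (k = 1..m) in terms of the free imaginary variables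
yt 0, ..., yt (nfree m - 1) (listed in the order of tilde y).\<close>
definition yfull :: "nat \<Rightarrow> (nat \<Rightarrow> real) \<Rightarrow> nat \<Rightarrow> real" where
  "yfull m yt k =
    (if even m then (if even k then yt (k div 2 - 1) else - yt ((k + 1) div 2 - 1))
     else if m = 1 then yt 0
     else (if k = m then yt ((m - 1) div 2)
           else if even k then yt (k div 2 - 1)
           else if k = m - 2 then - yt ((m - 1) div 2 - 1) - yt ((m - 1) div 2)
           else - yt ((k + 1) div 2 - 1)))"

text \<open>Variable layout of a point z in (q, x, tilde y):
q_j = z (j-1) (j = 1..n), x_k = z (n+k-1) (k = 1..m), tilde y_j = z (n+m+j).\<close>
definition svar :: "nat \<Rightarrow> nat \<Rightarrow> (nat \<Rightarrow> real) \<Rightarrow> nat \<Rightarrow> complex" where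
  "svar n m z l = Complex (z (n + l - 1)) (yfull m (\<lambda>j. z (n + m + j)) l)"

definition esym :: "nat \<Rightarrow> nat \<Rightarrow> nat \<Rightarrow> (nat \<Rightarrow> real) \<Rightarrow> complex" where
  "esym n m k z = (\<Sum>S\<in>{S. S \<subseteq> {1..m} \<and> card S = k}. \<Prod>l\<in>S. svar n m z l)"

definition Rk :: "nat \<Rightarrow> nat \<Rightarrow> nat \<Rightarrow> (nat \<Rightarrow> real) \<Rightarrow> real" where
  "Rk n m k z = Re (esym n m k z)"

definition Ik :: "nat \<Rightarrow> nat \<Rightarrow> nat \<Rightarrow> (nat \<Rightarrow> real) \<Rightarrow> real" where
  "Ik n m k z = Im (esym n m k z)"

definition feasible :: "nat \<Rightarrow> nat \<Rightarrow> (nat \<Rightarrow> (nat \<Rightarrow> real) \<Rightarrow> real) \<Rightarrow> nat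
    \<Rightarrow> ((nat \<Rightarrow> real) \<Rightarrow> real) \<Rightarrow> bool" where
  "feasible n m p d w \<longleftrightarrow> poly_fun n (2 * int d) w \<and>
    (\<exists>\<sigma>0 \<sigma> \<sigma>x \<tau>R \<tau>I.
       sos (n + m + nfree m) (int d) \<sigma>0 \<and>
       (\<forall>j\<in>{1..n}. sos (n + m + nfree m) (int d - 1) (\<sigma> j)) \<and>
       (\<forall>k\<in>{1..m-1}. sos (n + m + nfree m) (int d) (\<sigma>x k)) \<and>
       (\<forall>k\<in>{1..m}. poly_fun (n + m + nfree m) (2 * int d - int k) (\<tau>R k) \<and>
                   poly_fun (n + m + nfree m) (2 * int d - int k) (\<tau>I k)) \<and>
       (\<forall>z. z (n + m - 1) - w z =
           \<sigma>0 z
         + (\<Sum>j\<in>{1..n}. \<sigma> j z * (1 - (z (j - 1))^2))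
         + (\<Sum>k\<in>{1..m-1}. \<sigma>x k z * (z (n + m - 1) - z (n + k - 1)))
         + (\<Sum>k\<in>{1..m}. \<tau>R k z * ((-1)^k * p (m - k) z - Rk n m k z))
         + (\<Sum>k\<in>{1..m}. \<tau>I k z * Ik n m k z)))"

definition Leb :: "nat \<Rightarrow> (nat \<Rightarrow> real) measure" where
  "Leb n = PiM {..<n} (\<lambda>_. lborel)"

definition Qbox :: "nat \<Rightarrow> (nat \<Rightarrow> real) set" where
  "Qbox n = PiE {..<n} (\<lambda>_. {-1..1})"

definition rho :: "nat \<Rightarrow> nat \<Rightarrow> (nat \<Rightarrow> (nat \<Rightarrow> real) \<Rightarrow> real) \<Rightarrow> nat \<Rightarrow> real" where
  "rho n m p d = Sup {(LINT q:Qbox n|Leb n. w q) | w. feasible n m p d w}"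

end

theory Submission
  imports Defs "HOL-Computational_Algebra.Fundamental_Theorem_Algebra"
begin

text \<open>
  The constraints of the program describe the set \<open>K\<close> of triples \<open>(q, x, y)\<close> with \<open>q\<close> in the box and
  \<open>x\<^sub>1 + i y\<^sub>1, \<dots>, x\<^sub>m + i y\<^sub>m\<close> the roots of \<open>p(q, \<cdot>)\<close> listed with \<open>x\<^sub>m\<close> maximal. On \<open>K\<close> the
  coordinate \<open>x\<^sub>m\<close> is therefore the abscissa \<open>a(q)\<close>, and \<open>K\<close> projects onto the box because the roots
  of a real polynomial can be paired as the relations between the \<open>y\<^sub>k\<close> demand. Hence \<open>w \<le> a\<close> for
  every feasible \<open>w\<close>. Since \<open>K\<close> is compact (up to irrelevant coordinates), \<open>a\<close> is continuous.

  The quadratic module of the program is Archimedean: each root satisfies a monic equation whose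
  coefficients are polynomials in the bounded variables \<open>q\<close>, and the usual root bound has a
  sum of squares proof. By Putinar's Positivstellensatz every polynomial \<open>w < a\<close> is thus feasible
  for all large \<open>d\<close>. The Stone--Weierstrass theorem provides such \<open>w\<close> uniformly close to \<open>a\<close>, so
  \<open>\<rho>\<^sub>d\<close> tends to the integral of \<open>a\<close>, and \<open>w\<^sub>d \<le> a\<close> turns convergence of integrals into
  \<open>L\<^sup>1\<close> convergence.

  Putinar's theorem is proved algebraically. If \<open>-1 \<notin> M - f \<Sigma>\<close>, a maximal proper quadratic module
  \<open>S\<close> above \<open>M - f \<Sigma>\<close> is total, and \<open>a \<mapsto> sup {r. a - r \<in> S}\<close> is a character that is nonnegative on
  \<open>M\<close> but not positive at \<open>f\<close>. Otherwise \<open>s f - 1 \<in> M\<close> for a sum of squares \<open>s\<close>, which allows one to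
  lower \<open>r\<close> in \<open>f + r \<in> M\<close> by fixed steps until \<open>r = 0\<close>.
\<close>

section \<open>Quadratic modules\<close>

locale function_algebra =
  fixes A :: "('z \<Rightarrow> real) set"
  assumes const: "(\<lambda>_. c) \<in> A"
    and add: "f \<in> A \<Longrightarrow> g \<in> A \<Longrightarrow> (\<lambda>z. f z + g z) \<in> A"
    and mult: "f \<in> A \<Longrightarrow> g \<in> A \<Longrightarrow> (\<lambda>z. f z * g z) \<in> A"
begin

lemma scale: "f \<in> A \<Longrightarrow> (\<lambda>z. c * f z) \<in> A"
  by (rule mult[OF const])

lemma minus: "f \<in> A \<Longrightarrow> (\<lambda>z. - f z) \<in> A"
  using scale[of f "-1"] by simp

lemma diff: "f \<in> A \<Longrightarrow> g \<in> A \<Longrightarrow> (\<lambda>z. f z - g z) \<in> A"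
  using add[OF _ minus, of f g] by simp

lemma power: "f \<in> A \<Longrightarrow> (\<lambda>z. f z ^ k) \<in> A"
  by (induction k) (simp_all add: const mult)

lemma sum: "(\<And>i. i \<in> I \<Longrightarrow> f i \<in> A) \<Longrightarrow> (\<lambda>z. \<Sum>i\<in>I. f i z) \<in> A"
  by (induction I rule: infinite_finite_induct) (simp_all add: const add)

lemma prod: "(\<And>i. i \<in> I \<Longrightarrow> f i \<in> A) \<Longrightarrow> (\<lambda>z. \<Prod>i\<in>I. f i z) \<in> A"
  by (induction I rule: infinite_finite_induct) (simp_all add: const mult)

lemmas closed = const add mult scale minus diff power sum prod

inductive_set SOS :: "('z \<Rightarrow> real) set" where
  square: "g \<in> A \<Longrightarrow> (\<lambda>z. (g z)\<^sup>2) \<in> SOS"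
| plus: "s \<in> SOS \<Longrightarrow> t \<in> SOS \<Longrightarrow> (\<lambda>z. s z + t z) \<in> SOS"

lemma SOS_subset: "SOS \<subseteq> A"
proof
  show "s \<in> A" if "s \<in> SOS" for s
    using that by induction (auto intro: closed)
qed

lemma SOS_const: "c \<ge> 0 \<Longrightarrow> (\<lambda>_. c) \<in> SOS"
  using square[OF const[of "sqrt c"]] by simp

lemma SOS_square_mult: "s \<in> SOS \<Longrightarrow> g \<in> A \<Longrightarrow> (\<lambda>z. (g z)\<^sup>2 * s z) \<in> SOS"
proof (induction rule: SOS.induct)
  case (square h)
  then show ?case using SOS.square[OF mult[of g h]] by (simp add: power_mult_distrib)
next
  case (plus s t)
  then show ?case
    using SOS.plus[of "\<lambda>z. (g z)\<^sup>2 * s z" "\<lambda>z. (g z)\<^sup>2 * t z"] by (simp add: distrib_left)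
qed

end

locale quadratic_module = function_algebra A for A :: "('z \<Rightarrow> real) set" +
  fixes M :: "('z \<Rightarrow> real) set"
  assumes qm_subset: "M \<subseteq> A"
    and qm_one: "(\<lambda>_. 1) \<in> M"
    and qm_add: "f \<in> M \<Longrightarrow> g \<in> M \<Longrightarrow> (\<lambda>z. f z + g z) \<in> M"
    and qm_square_mult: "g \<in> A \<Longrightarrow> f \<in> M \<Longrightarrow> (\<lambda>z. (g z)\<^sup>2 * f z) \<in> M"
begin

lemma qm_scale:
  assumes "f \<in> M" "c \<ge> 0"
  shows "(\<lambda>z. c * f z) \<in> M"
  using qm_square_mult[OF const[of "sqrt c"] assms(1)] assms(2) by simp

lemma qm_const: "c \<ge> 0 \<Longrightarrow> (\<lambda>_. c) \<in> M"
  using qm_scale[OF qm_one, of c] by simp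

lemma qm_sum: "(\<And>i. i \<in> I \<Longrightarrow> f i \<in> M) \<Longrightarrow> (\<lambda>z. \<Sum>i\<in>I. f i z) \<in> M"
  by (induction I rule: infinite_finite_induct) (simp_all add: qm_const qm_add)

lemma qm_square: "g \<in> A \<Longrightarrow> (\<lambda>z. (g z)\<^sup>2) \<in> M"
  using qm_square_mult[OF _ qm_one, of g] by simp

lemma qm_SOS_mult:
  assumes "s \<in> SOS" "f \<in> M"
  shows "(\<lambda>z. s z * f z) \<in> M"
  using assms(1)
proof induction
  case (square g)
  then show ?case using assms(2) by (rule qm_square_mult)
next
  case (plus s t)
  then show ?case using qm_add by (fastforce simp: distrib_right)
qed

lemma SOS_subset_qm: "SOS \<subseteq> M"
  using qm_SOS_mult[OF _ qm_one] by auto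

definition qm_le :: "('z \<Rightarrow> real) \<Rightarrow> ('z \<Rightarrow> real) \<Rightarrow> bool" (infix "\<preceq>" 50) where
  "f \<preceq> g \<longleftrightarrow> (\<lambda>z. g z - f z) \<in> M"

lemma qm_leI: "h \<in> M \<Longrightarrow> (\<And>z. h z = g z - f z) \<Longrightarrow> f \<preceq> g"
  unfolding qm_le_def using ext[of h "\<lambda>z. g z - f z"] by simp

lemma zero_qm_le_iff: "(\<lambda>_. 0) \<preceq> f \<longleftrightarrow> f \<in> M"
  by (simp add: qm_le_def)

lemma qm_le_refl: "f \<preceq> f"
  by (rule qm_leI[OF qm_const[of 0]]) auto

lemma qm_le_trans [trans]: "f \<preceq> g \<Longrightarrow> g \<preceq> h \<Longrightarrow> f \<preceq> h"
  unfolding qm_le_def[of f g] qm_le_def[of g h] by (erule (1) qm_leI[OF qm_add]) simp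

lemma qm_le_minus: "f \<preceq> g \<Longrightarrow> (\<lambda>z. - g z) \<preceq> (\<lambda>z. - f z)"
  by (simp add: qm_le_def)

lemma qm_le_add: "f \<preceq> g \<Longrightarrow> f' \<preceq> g' \<Longrightarrow> (\<lambda>z. f z + f' z) \<preceq> (\<lambda>z. g z + g' z)"
  unfolding qm_le_def[of f g] qm_le_def[of f' g'] by (erule (1) qm_leI[OF qm_add]) simp

lemma qm_le_sum:
  "(\<And>i. i \<in> I \<Longrightarrow> f i \<preceq> g i) \<Longrightarrow> (\<lambda>z. \<Sum>i\<in>I. f i z) \<preceq> (\<lambda>z. \<Sum>i\<in>I. g i z)"
  by (induction I rule: infinite_finite_induct) (simp_all add: qm_le_refl qm_le_add)

lemma qm_le_SOS_mult: "f \<preceq> g \<Longrightarrow> s \<in> SOS \<Longrightarrow> (\<lambda>z. s z * f z) \<preceq> (\<lambda>z. s z * g z)"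
  unfolding qm_le_def[of f g]
  by (erule (1) qm_leI[OF qm_SOS_mult[rotated]]) (simp add: right_diff_distrib)

lemma qm_le_scale: "f \<preceq> g \<Longrightarrow> c \<ge> 0 \<Longrightarrow> (\<lambda>z. c * f z) \<preceq> (\<lambda>z. c * g z)"
  using qm_le_SOS_mult[OF _ SOS_const] .

lemma qm_le_const: "r \<le> t \<Longrightarrow> (\<lambda>_. r) \<preceq> (\<lambda>_. t)"
  by (simp add: qm_le_def qm_const)

text \<open>A quadratic module is not closed under products, but
  \<open>(c - a) (c + a) = ((c - a)\<^sup>2 (c + a) + (c + a)\<^sup>2 (c - a)) / (2 c)\<close>.\<close>

lemma qm_le_square:
  assumes a: "a \<in> A" and c: "c > 0" and lower: "(\<lambda>_. - c) \<preceq> a" and upper: "a \<preceq> (\<lambda>_. c)"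
  shows "(\<lambda>z. (a z)\<^sup>2) \<preceq> (\<lambda>_. c\<^sup>2)"
proof (rule qm_leI)
  have "(\<lambda>z. c - a z) \<in> M" "(\<lambda>z. c + a z) \<in> M"
    using lower upper by (simp_all add: qm_le_def add.commute)
  then have "(\<lambda>z. (c - a z)\<^sup>2 * (c + a z)) \<in> M" "(\<lambda>z. (c + a z)\<^sup>2 * (c - a z)) \<in> M"
    using a by (auto intro!: qm_square_mult closed)
  then show "(\<lambda>z. 1 / (2 * c) * ((c - a z)\<^sup>2 * (c + a z) + (c + a z)\<^sup>2 * (c - a z))) \<in> M"
    using c by (intro qm_scale qm_add) auto
  show "1 / (2 * c) * ((c - a z)\<^sup>2 * (c + a z) + (c + a z)\<^sup>2 * (c - a z)) = c\<^sup>2 - (a z)\<^sup>2" for z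
    using c by (simp add: field_simps power2_eq_square)
qed

definition support :: "('z \<Rightarrow> real) set" where
  "support = {f. f \<in> M \<and> (\<lambda>z. - f z) \<in> M}"

lemma support_add: "f \<in> support \<Longrightarrow> g \<in> support \<Longrightarrow> (\<lambda>z. f z + g z) \<in> support"
  using qm_add[of f g] qm_add[of "\<lambda>z. - f z" "\<lambda>z. - g z"] by (simp add: support_def)

lemma support_minus: "f \<in> support \<Longrightarrow> (\<lambda>z. - f z) \<in> support"
  by (simp add: support_def)

lemma support_mult:
  assumes f: "f \<in> support" and g: "g \<in> A"
  shows "(\<lambda>z. g z * f z) \<in> support"
proof -
  have in_M: "(\<lambda>z. g z * h z) \<in> M" if h: "h \<in> support" for h
  proof -
    have "(\<lambda>z. ((g z + 1) / 2)\<^sup>2 * h z + ((g z - 1) / 2)\<^sup>2 * (- h z)) \<in> M"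
      using h unfolding support_def divide_inverse
      by (intro qm_add qm_square_mult closed g) auto
    also have "(\<lambda>z. ((g z + 1) / 2)\<^sup>2 * h z + ((g z - 1) / 2)\<^sup>2 * (- h z)) = (\<lambda>z. g z * h z)"
      by (simp add: fun_eq_iff power2_eq_square field_simps)
    finally show ?thesis .
  qed
  show ?thesis
    using in_M[OF f] in_M[OF support_minus[OF f]] by (simp add: support_def)
qed

definition adjoin :: "('z \<Rightarrow> real) \<Rightarrow> ('z \<Rightarrow> real) set" where
  "adjoin f = {(\<lambda>z. h z + s z * f z) | h s. h \<in> M \<and> s \<in> SOS}"

lemma adjoinI: "h \<in> M \<Longrightarrow> s \<in> SOS \<Longrightarrow> (\<And>z. g z = h z + s z * f z) \<Longrightarrow> g \<in> adjoin f"
  by (auto simp: adjoin_def fun_eq_iff)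

lemma adjoinE:
  assumes "g \<in> adjoin f"
  obtains h s where "h \<in> M" "s \<in> SOS" "g = (\<lambda>z. h z + s z * f z)"
  using assms by (auto simp: adjoin_def)

lemma adjoin_superset: "M \<subseteq> adjoin f"
  using adjoinI[OF _ SOS_const[of 0]] by auto

lemma mem_adjoin: "f \<in> adjoin f"
  using adjoinI[OF qm_const[of 0] SOS_const[of 1]] by simp

lemma minus_one_mem_adjoin_iff:
  "(\<lambda>_. -1) \<in> adjoin f \<longleftrightarrow> (\<exists>s\<in>SOS. (\<lambda>z. s z * f z) \<preceq> (\<lambda>_. -1))"
proof
  assume "(\<lambda>_. -1) \<in> adjoin f"
  then obtain h s where "h \<in> M" "s \<in> SOS" and "(\<lambda>_. -1) = (\<lambda>z. h z + s z * f z)"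
    by (rule adjoinE)
  then show "\<exists>s\<in>SOS. (\<lambda>z. s z * f z) \<preceq> (\<lambda>_. -1)"
    by (intro bexI[of _ s] qm_leI[of h]) (simp_all add: fun_eq_iff eq_diff_eq)
qed (auto simp: qm_le_def intro: adjoinI)

lemma quadratic_module_adjoin:
  assumes f: "f \<in> A"
  shows "quadratic_module A (adjoin f)"
proof
  show "adjoin f \<subseteq> A"
    using qm_subset SOS_subset f by (auto elim!: adjoinE intro!: closed)
  show "(\<lambda>_. 1) \<in> adjoin f"
    using adjoin_superset qm_one by blast
next
  fix a b assume "a \<in> adjoin f" "b \<in> adjoin f"
  then obtain h s h' s' where "h \<in> M" "s \<in> SOS" "h' \<in> M" "s' \<in> SOS"
    and "a = (\<lambda>z. h z + s z * f z)" "b = (\<lambda>z. h' z + s' z * f z)"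
    by (elim adjoinE)
  then show "(\<lambda>z. a z + b z) \<in> adjoin f"
    by (intro adjoinI[OF qm_add SOS.plus, of h h' s s']) (simp_all add: algebra_simps)
next
  fix g a assume "g \<in> A" "a \<in> adjoin f"
  then obtain h s where "g \<in> A" "h \<in> M" "s \<in> SOS" and "a = (\<lambda>z. h z + s z * f z)"
    by (elim adjoinE)
  then show "(\<lambda>z. (g z)\<^sup>2 * a z) \<in> adjoin f"
    by (intro adjoinI[OF qm_square_mult SOS_square_mult, of g h s g]) (simp_all add: algebra_simps)
qed

end

context function_algebra
begin

lemma quadratic_module_SOS: "quadratic_module A SOS"
  by unfold_locales
    (use SOS_subset SOS_const[of 1] in \<open>auto intro: SOS.plus SOS_square_mult\<close>)

lemmas SOS_mult = quadratic_module.qm_SOS_mult[OF quadratic_module_SOS]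

lemmas SOS_scale = quadratic_module.qm_scale[OF quadratic_module_SOS]

lemma SOS_power: "s \<in> SOS \<Longrightarrow> (\<lambda>z. s z ^ k) \<in> SOS"
  by (induction k) (simp_all add: SOS_const SOS_mult)

lemma quadratic_module_Union_chain:
  assumes "C \<noteq> {}" and chain: "subset.chain {S. quadratic_module A S} C"
  shows "quadratic_module A (\<Union>C)"
proof -
  have qm: "quadratic_module A S" if "S \<in> C" for S
    using chain that by (auto simp: subset.chain_def)
  have linear: "S \<subseteq> T \<or> T \<subseteq> S" if "S \<in> C" "T \<in> C" for S T
    using chain that by (auto simp: subset.chain_def)
  show ?thesis
  proof
    show "\<Union>C \<subseteq> A" using quadratic_module.qm_subset[OF qm] by blast
    show "(\<lambda>_. 1) \<in> \<Union>C" using \<open>C \<noteq> {}\<close> quadratic_module.qm_one[OF qm] by blast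
    show "(\<lambda>z. f z + g z) \<in> \<Union>C" if fg: "f \<in> \<Union>C" "g \<in> \<Union>C" for f g
    proof -
      obtain S where "S \<in> C" "f \<in> S" "g \<in> S" using fg linear by blast
      then show ?thesis using quadratic_module.qm_add[OF qm] by blast
    qed
    show "(\<lambda>z. (g z)\<^sup>2 * f z) \<in> \<Union>C" if "g \<in> A" "f \<in> \<Union>C" for g f
      using that quadratic_module.qm_square_mult[OF qm] by blast
  qed
qed

end

locale total_quadratic_module = quadratic_module A M for A M :: "('z \<Rightarrow> real) set" +
  assumes proper: "(\<lambda>_. -1) \<notin> M"
    and total: "a \<in> A \<Longrightarrow> a \<in> M \<or> (\<lambda>z. - a z) \<in> M"

context quadratic_module
begin

lemma maximal_proper_extension:
  assumes proper: "(\<lambda>_. -1) \<notin> M"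
  obtains S where "quadratic_module A S" "M \<subseteq> S" "(\<lambda>_. -1) \<notin> S"
    "\<And>T. quadratic_module A T \<Longrightarrow> S \<subseteq> T \<Longrightarrow> (\<lambda>_. -1) \<notin> T \<Longrightarrow> T = S"
proof -
  define Q where "Q = {S. quadratic_module A S \<and> M \<subseteq> S \<and> (\<lambda>_. -1) \<notin> S}"
  have "\<exists>S\<in>Q. \<forall>T\<in>Q. S \<subseteq> T \<longrightarrow> T = S"
  proof (rule subset_Zorn_nonempty)
    show "Q \<noteq> {}" using proper quadratic_module_axioms by (auto simp: Q_def)
    fix C assume "C \<noteq> {}" and chain: "subset.chain Q C"
    then have "quadratic_module A (\<Union>C)"
      by (intro quadratic_module_Union_chain) (auto simp: subset.chain_def Q_def)
    then show "\<Union>C \<in> Q" using \<open>C \<noteq> {}\<close> chain by (auto simp: subset.chain_def Q_def)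
  qed
  then obtain S where S: "S \<in> Q" and maximal: "\<And>T. T \<in> Q \<Longrightarrow> S \<subseteq> T \<Longrightarrow> T = S" by blast
  show ?thesis
  proof (rule that[of S])
    show "T = S" if "quadratic_module A T" "S \<subseteq> T" "(\<lambda>_. -1) \<notin> T" for T
      using that S by (intro maximal) (auto simp: Q_def)
  qed (use S in \<open>auto simp: Q_def\<close>)
qed

lemma maximal_proper_imp_total:
  assumes proper: "(\<lambda>_. -1) \<notin> M"
    and maximal: "\<And>T. quadratic_module A T \<Longrightarrow> M \<subseteq> T \<Longrightarrow> (\<lambda>_. -1) \<notin> T \<Longrightarrow> T = M"
  shows "total_quadratic_module A M"
proof
  fix a assume a: "a \<in> A"
  show "a \<in> M \<or> (\<lambda>z. - a z) \<in> M"
  proof (rule ccontr)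
    assume neither: "\<not> ?thesis"
    have adjoin_improper: "\<exists>s\<in>SOS. (\<lambda>z. s z * b z) \<preceq> (\<lambda>_. -1)" if "b \<in> A" "b \<notin> M" for b
      using maximal[OF quadratic_module_adjoin[OF that(1)] adjoin_superset] mem_adjoin[of b] that(2)
      by (auto simp flip: minus_one_mem_adjoin_iff)
    obtain s where s: "s \<in> SOS" and s_le: "(\<lambda>z. s z * a z) \<preceq> (\<lambda>_. -1)"
      using adjoin_improper[OF a] neither by blast
    obtain t where t: "t \<in> SOS" and "(\<lambda>z. t z * (- a z)) \<preceq> (\<lambda>_. -1)"
      using adjoin_improper[OF minus[OF a]] neither by blast
    then have le_t: "(\<lambda>_. 1) \<preceq> (\<lambda>z. t z * a z)"
      using qm_le_minus by fastforce
    have "s \<preceq> (\<lambda>z. s z * (t z * a z))"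
      using qm_le_SOS_mult[OF le_t s] by simp
    also have "(\<lambda>z. s z * (t z * a z)) = (\<lambda>z. t z * (s z * a z))"
      by (simp add: mult_ac)
    also have "\<dots> \<preceq> (\<lambda>z. - t z)"
      using qm_le_SOS_mult[OF s_le t] by simp
    also have "\<dots> \<preceq> (\<lambda>_. 0)"
      using t SOS_subset_qm by (auto simp: qm_le_def)
    finally have "s \<in> support"
      using s SOS_subset_qm by (auto simp: support_def qm_le_def)
    then have "(\<lambda>_. 0) \<preceq> (\<lambda>z. s z * a z)"
      using support_mult[OF _ a, of s]
      by (simp add: zero_qm_le_iff support_def mult.commute[of "a _"])
    also note s_le
    finally show False using proper by (simp add: zero_qm_le_iff)
  qed
qed fact

lemma total_extension:
  assumes "(\<lambda>_. -1) \<notin> M"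
  obtains S where "total_quadratic_module A S" "M \<subseteq> S"
proof -
  obtain S where "quadratic_module A S" "M \<subseteq> S" "(\<lambda>_. -1) \<notin> S"
    and maximal: "\<And>T. quadratic_module A T \<Longrightarrow> S \<subseteq> T \<Longrightarrow> (\<lambda>_. -1) \<notin> T \<Longrightarrow> T = S"
    using maximal_proper_extension[OF assms] by blast
  then show ?thesis
    using that[OF quadratic_module.maximal_proper_imp_total] by blast
qed

end

section \<open>Putinar's Positivstellensatz\<close>

locale archimedean_module = quadratic_module A M for A M :: "('z \<Rightarrow> real) set" +
  assumes archimedean: "a \<in> A \<Longrightarrow> \<exists>c. a \<preceq> (\<lambda>_. c)"

locale total_archimedean_module =
  total_quadratic_module A M + archimedean_module A M for A M :: "('z \<Rightarrow> real) set"
begin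

lemma const_qm_le_const_iff: "(\<lambda>_. r) \<preceq> (\<lambda>_. t) \<longleftrightarrow> r \<le> t"
proof
  assume "(\<lambda>_. r) \<preceq> (\<lambda>_. t)"
  then have "(\<lambda>_. inverse (r - t) * (t - r)) \<in> M" if "t < r"
    using that unfolding qm_le_def by (intro qm_scale) auto
  moreover have "inverse (r - t) * (t - r) = -1" if "t < r"
    using that by (simp add: field_simps)
  ultimately show "r \<le> t" using proper by fastforce
qed (rule qm_le_const)

definition standard_part :: "('z \<Rightarrow> real) \<Rightarrow> real" where
  "standard_part a = Sup {r. (\<lambda>_. r) \<preceq> a}"

lemma bdd_above_lower_bounds:
  assumes "a \<in> A"
  shows "bdd_above {r. (\<lambda>_. r) \<preceq> a}"
proof -
  obtain c where "a \<preceq> (\<lambda>_. c)" using archimedean[OF assms] by blast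
  then have "r \<le> c" if "(\<lambda>_. r) \<preceq> a" for r
    using qm_le_trans[OF that] const_qm_le_const_iff by blast
  then show ?thesis by (auto simp: bdd_above_def)
qed

lemma lower_bounds_nonempty:
  assumes "a \<in> A"
  shows "{r. (\<lambda>_. r) \<preceq> a} \<noteq> {}"
proof -
  obtain c where "(\<lambda>z. - a z) \<preceq> (\<lambda>_. c)" using archimedean[OF minus[OF assms]] by blast
  then have "(\<lambda>_. - c) \<preceq> a" using qm_le_minus by fastforce
  then show ?thesis by blast
qed

lemma le_standard_part: "a \<in> A \<Longrightarrow> (\<lambda>_. r) \<preceq> a \<Longrightarrow> r \<le> standard_part a"
  unfolding standard_part_def by (intro cSup_upper bdd_above_lower_bounds) auto

lemma less_standard_part_imp_qm_le:
  assumes "a \<in> A" "r < standard_part a"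
  shows "(\<lambda>_. r) \<preceq> a"
proof -
  obtain t where "(\<lambda>_. t) \<preceq> a" "r < t"
    using less_cSup_iff[OF lower_bounds_nonempty bdd_above_lower_bounds] assms
    unfolding standard_part_def by blast
  then show ?thesis using qm_le_trans[OF qm_le_const[of r t]] by simp
qed

lemma standard_part_le:
  assumes a: "a \<in> A" "a \<preceq> (\<lambda>_. r)"
  shows "standard_part a \<le> r"
proof (rule dense_le)
  fix t assume "t < standard_part a"
  then have "(\<lambda>_. t) \<preceq> (\<lambda>_. r)"
    using less_standard_part_imp_qm_le[OF a(1)] qm_le_trans a(2) by blast
  then show "t \<le> r" by (simp add: const_qm_le_const_iff)
qed

lemma standard_part_less_imp_qm_le:
  assumes a: "a \<in> A" and less: "standard_part a < r"
  shows "a \<preceq> (\<lambda>_. r)"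
proof -
  have "\<not> (\<lambda>_. r) \<preceq> a" using le_standard_part[OF a] less by fastforce
  then show ?thesis using total[OF diff[OF a const[of r]]] by (simp add: qm_le_def)
qed

lemma standard_part_eqI:
  assumes a: "a \<in> A"
    and lower: "\<And>e. e > 0 \<Longrightarrow> (\<lambda>_. c - e) \<preceq> a" and upper: "\<And>e. e > 0 \<Longrightarrow> a \<preceq> (\<lambda>_. c + e)"
  shows "standard_part a = c"
proof (rule antisym; rule field_le_epsilon)
  fix e :: real assume "e > 0"
  then show "standard_part a \<le> c + e" "c \<le> standard_part a + e"
    using standard_part_le[OF a upper] le_standard_part[OF a lower[of e]] by auto
qed

lemma standard_part_const: "standard_part (\<lambda>_. c) = c"
  by (rule standard_part_eqI) (auto intro: const qm_le_const)

lemma standard_part_add: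
  assumes f: "f \<in> A" and g: "g \<in> A"
  shows "standard_part (\<lambda>z. f z + g z) = standard_part f + standard_part g"
proof (rule standard_part_eqI[OF add[OF f g]])
  fix e :: real assume e: "e > 0"
  show "(\<lambda>_. standard_part f + standard_part g - e) \<preceq> (\<lambda>z. f z + g z)"
    using qm_le_add[OF less_standard_part_imp_qm_le[OF f, of "standard_part f - e / 2"]
        less_standard_part_imp_qm_le[OF g, of "standard_part g - e / 2"]] e
    by (simp add: algebra_simps)
  show "(\<lambda>z. f z + g z) \<preceq> (\<lambda>_. standard_part f + standard_part g + e)"
    using qm_le_add[OF standard_part_less_imp_qm_le[OF f, of "standard_part f + e / 2"]
        standard_part_less_imp_qm_le[OF g, of "standard_part g + e / 2"]] e
    by (simp add: algebra_simps)
qed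

lemma standard_part_scale_pos:
  assumes f: "f \<in> A" and c: "c > 0"
  shows "standard_part (\<lambda>z. c * f z) = c * standard_part f"
proof (rule standard_part_eqI[OF scale[OF f]])
  fix e :: real assume e: "e > 0"
  show "(\<lambda>_. c * standard_part f - e) \<preceq> (\<lambda>z. c * f z)"
    using qm_le_scale[OF less_standard_part_imp_qm_le[OF f, of "standard_part f - e / c"], of c] c e
    by (simp add: right_diff_distrib)
  show "(\<lambda>z. c * f z) \<preceq> (\<lambda>_. c * standard_part f + e)"
    using qm_le_scale[OF standard_part_less_imp_qm_le[OF f, of "standard_part f + e / c"], of c] c e
    by (simp add: distrib_left)
qed

lemma standard_part_scale:
  assumes f: "f \<in> A"
  shows "standard_part (\<lambda>z. c * f z) = c * standard_part f"
proof (cases c "0 :: real" rule: linorder_cases)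
  case less
  have "0 = standard_part (\<lambda>z. c * f z + (- c) * f z)" by (simp add: standard_part_const)
  also have "\<dots> = standard_part (\<lambda>z. c * f z) + (- c) * standard_part f"
    using less standard_part_add[OF scale[OF f, of c] scale[OF f, of "- c"]]
      standard_part_scale_pos[OF f, of "- c"] by simp
  finally show ?thesis by simp
qed (simp_all add: standard_part_const standard_part_scale_pos[OF f])

lemma standard_part_square_eq_0:
  assumes f: "f \<in> A" and zero: "standard_part f = 0"
  shows "standard_part (\<lambda>z. (f z)\<^sup>2) = 0"
proof (rule standard_part_eqI[OF power[OF f]])
  fix e :: real assume e: "e > 0"
  have "(\<lambda>_. 0 - e) \<preceq> (\<lambda>_. 0)" using e by (intro qm_le_const) simp
  also have "\<dots> \<preceq> (\<lambda>z. (f z)\<^sup>2)" using qm_square[OF f] by (simp add: zero_qm_le_iff)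
  finally show "(\<lambda>_. 0 - e) \<preceq> (\<lambda>z. (f z)\<^sup>2)" .
  have "(\<lambda>_. - sqrt e) \<preceq> f" "f \<preceq> (\<lambda>_. sqrt e)"
    using e zero by (auto intro: less_standard_part_imp_qm_le standard_part_less_imp_qm_le f)
  from qm_le_square[OF f _ this] show "(\<lambda>z. (f z)\<^sup>2) \<preceq> (\<lambda>_. 0 + e)" using e by simp
qed

lemma standard_part_square:
  assumes f: "f \<in> A"
  shows "standard_part (\<lambda>z. (f z)\<^sup>2) = (standard_part f)\<^sup>2"
proof -
  define r where "r = standard_part f"
  define f0 where "f0 z = f z + (- r)" for z
  have f0: "f0 \<in> A" unfolding f0_def[abs_def] by (intro closed f)
  have "standard_part f0 = standard_part f + standard_part (\<lambda>_. - r)"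
    unfolding f0_def[abs_def] by (rule standard_part_add[OF f const])
  then have "standard_part f0 = 0" by (simp add: standard_part_const r_def)
  moreover have "(\<lambda>z. (f z)\<^sup>2) = (\<lambda>z. (f0 z)\<^sup>2 + (2 * r * f0 z + r\<^sup>2))"
    by (simp add: f0_def power2_eq_square algebra_simps)
  ultimately show ?thesis
    using f0 by (simp add: standard_part_add standard_part_scale standard_part_const closed
        standard_part_square_eq_0 r_def)
qed

lemma standard_part_mult:
  assumes f: "f \<in> A" and g: "g \<in> A"
  shows "standard_part (\<lambda>z. f z * g z) = standard_part f * standard_part g"
proof -
  have "(standard_part f + standard_part g)\<^sup>2 = standard_part (\<lambda>z. (f z + g z)\<^sup>2)"
    by (simp add: standard_part_square standard_part_add f g add)
  also have "(\<lambda>z. (f z + g z)\<^sup>2) = (\<lambda>z. (f z)\<^sup>2 + ((g z)\<^sup>2 + 2 * (f z * g z)))"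
    by (simp add: power2_eq_square algebra_simps)
  also have "standard_part \<dots> =
      (standard_part f)\<^sup>2 + ((standard_part g)\<^sup>2 + 2 * standard_part (\<lambda>z. f z * g z))"
    using f g by (simp add: standard_part_add standard_part_scale standard_part_square closed)
  finally show ?thesis by (simp add: power2_eq_square algebra_simps)
qed

lemma standard_part_nonneg: "a \<in> M \<Longrightarrow> standard_part a \<ge> 0"
  using le_standard_part[of a 0] qm_subset by (auto simp: zero_qm_le_iff)

end

definition (in function_algebra) character :: "(('z \<Rightarrow> real) \<Rightarrow> real) \<Rightarrow> bool" where
  "character \<phi> \<longleftrightarrow> (\<forall>c. \<phi> (\<lambda>_. c) = c) \<and>
     (\<forall>f\<in>A. \<forall>g\<in>A. \<phi> (\<lambda>z. f z + g z) = \<phi> f + \<phi> g) \<and>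
     (\<forall>f\<in>A. \<forall>g\<in>A. \<phi> (\<lambda>z. f z * g z) = \<phi> f * \<phi> g)"

lemma (in total_archimedean_module) character_standard_part: "character standard_part"
  by (simp add: character_def standard_part_const standard_part_add standard_part_mult)

context archimedean_module
begin

lemma positive_imp_SOS_multiple_ge_one:
  assumes f: "f \<in> A"
    and pos: "\<And>\<phi>. character \<phi> \<Longrightarrow> (\<And>a. a \<in> M \<Longrightarrow> \<phi> a \<ge> 0) \<Longrightarrow> \<phi> f > 0"
  obtains s where "s \<in> SOS" "(\<lambda>_. 1) \<preceq> (\<lambda>z. s z * f z)"
proof -
  interpret N: quadratic_module A "adjoin (\<lambda>z. - f z)"
    by (rule quadratic_module_adjoin[OF minus[OF f]])
  have "(\<lambda>_. -1) \<in> adjoin (\<lambda>z. - f z)"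
  proof (rule ccontr)
    assume "(\<lambda>_. -1) \<notin> adjoin (\<lambda>z. - f z)"
    then obtain S where "total_quadratic_module A S" and S: "adjoin (\<lambda>z. - f z) \<subseteq> S"
      by (rule N.total_extension)
    then interpret S: total_quadratic_module A S by simp
    have "M \<subseteq> S" using adjoin_superset S by blast
    then interpret S: total_archimedean_module A S
    proof unfold_locales
      show "\<exists>c. S.qm_le a (\<lambda>_. c)" if "a \<in> A" for a
        using archimedean[OF that] \<open>M \<subseteq> S\<close> unfolding qm_le_def S.qm_le_def by blast
    qed
    let ?\<phi> = S.standard_part
    have "?\<phi> f > 0"
      using \<open>M \<subseteq> S\<close> by (intro pos S.character_standard_part S.standard_part_nonneg) blast
    moreover have "?\<phi> (\<lambda>z. - f z) \<ge> 0"
      using mem_adjoin S by (intro S.standard_part_nonneg) blast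
    ultimately show False using S.standard_part_scale[OF f, of "-1"] by simp
  qed
  then show ?thesis
    using that qm_le_minus by (fastforce simp: minus_one_mem_adjoin_iff)
qed

text \<open>Here \<open>N\<^sup>2 (f + r) = (N - s)\<^sup>2 (f + r) + s (2 N - s) (f + r)\<close>, and for large \<open>N\<close> the last
  summand is at least \<open>2 N - s\<^sup>2 f \<succeq> 1\<close>.\<close>

lemma descent_step:
  assumes f: "f \<in> A" and s: "s \<in> SOS" and sf: "(\<lambda>_. 1) \<preceq> (\<lambda>z. s z * f z)"
  obtains \<delta> where "\<delta> > 0" "\<And>r. r \<ge> 0 \<Longrightarrow> (\<lambda>z. f z + r) \<in> M \<Longrightarrow> (\<lambda>z. f z + (r - \<delta>)) \<in> M"
proof -
  have sA: "s \<in> A" using s SOS_subset by blast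
  obtain b where b: "s \<preceq> (\<lambda>_. b)" using archimedean[OF sA] by blast
  obtain c where c: "(\<lambda>z. (s z)\<^sup>2 * f z) \<preceq> (\<lambda>_. c)"
    using archimedean[OF mult[OF power[OF sA] f]] by blast
  define N where "N = max 1 (max b (c + 1))"
  have "1 \<le> N" "b \<le> N" "c + 1 \<le> N" by (auto simp: N_def)
  then have N: "N > 0" "b \<le> 2 * N" "c \<le> 2 * N - 1" by linarith+
  show ?thesis
  proof (rule that[of "1 / N\<^sup>2"])
    fix r :: real assume r: "r \<ge> 0" and fr: "(\<lambda>z. f z + r) \<in> M"
    have "s \<preceq> (\<lambda>_. 2 * N)" using b qm_le_const[OF N(2)] by (rule qm_le_trans)
    then have shift: "(\<lambda>z. r * (s z * (2 * N - s z))) \<in> M"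
      unfolding qm_le_def using r s by (intro qm_scale qm_SOS_mult)
    have bound: "(\<lambda>z. 2 * N - 1 - (s z)\<^sup>2 * f z) \<in> M"
      using qm_le_trans[OF c qm_le_const[OF N(3)]] by (simp add: qm_le_def)
    have multiple: "(\<lambda>z. 2 * N * (s z * f z - 1)) \<in> M"
      using sf N unfolding qm_le_def by (intro qm_scale) auto
    have square: "(\<lambda>z. (N - s z)\<^sup>2 * (f z + r)) \<in> M"
      by (intro qm_square_mult fr closed sA)
    have "(\<lambda>z. 1 / N\<^sup>2 * ((N - s z)\<^sup>2 * (f z + r) + (2 * N * (s z * f z - 1) +
        ((2 * N - 1 - (s z)\<^sup>2 * f z) + r * (s z * (2 * N - s z)))))) \<in> M"
      by (rule qm_scale[OF qm_add[OF square qm_add[OF multiple qm_add[OF bound shift]]]]) simp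
    also have "(\<lambda>z. 1 / N\<^sup>2 * ((N - s z)\<^sup>2 * (f z + r) + (2 * N * (s z * f z - 1) +
        ((2 * N - 1 - (s z)\<^sup>2 * f z) + r * (s z * (2 * N - s z)))))) = (\<lambda>z. f z + (r - 1 / N\<^sup>2))"
      using N by (simp add: fun_eq_iff field_simps power2_eq_square)
    finally show "(\<lambda>z. f z + (r - 1 / N\<^sup>2)) \<in> M" .
  qed (use N in auto)
qed

lemma SOS_multiple_ge_one_imp_mem:
  assumes f: "f \<in> A" and s: "s \<in> SOS" and sf: "(\<lambda>_. 1) \<preceq> (\<lambda>z. s z * f z)"
  shows "f \<in> M"
proof -
  obtain \<delta> where \<delta>: "\<delta> > 0"
    and step: "\<And>r. r \<ge> 0 \<Longrightarrow> (\<lambda>z. f z + r) \<in> M \<Longrightarrow> (\<lambda>z. f z + (r - \<delta>)) \<in> M"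
    using descent_step[OF assms] by blast
  have weaken: "(\<lambda>z. f z + t) \<in> M" if "(\<lambda>z. f z + r) \<in> M" "r \<le> t" for r t
    using qm_add[OF that(1) qm_const[of "t - r"]] that(2) by simp
  obtain c where c: "(\<lambda>z. - f z) \<preceq> (\<lambda>_. c)" using archimedean[OF minus[OF f]] by blast
  obtain k :: nat where less: "c < real k * \<delta>"
    using reals_Archimedean3[OF \<delta>] by blast
  have "(\<lambda>z. f z + max 0 (c - real k * \<delta>)) \<in> M" for k
  proof (induction k)
    case 0
    have "(\<lambda>z. f z + c) \<in> M" using c by (simp add: qm_le_def add.commute[of c])
    then show ?case by (rule weaken) simp
  next
    case (Suc k)
    then have "(\<lambda>z. f z + (max 0 (c - real k * \<delta>) - \<delta>)) \<in> M" by (intro step) simp_all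
    then show ?case by (rule weaken) (use \<delta> in \<open>simp add: distrib_right\<close>)
  qed
  from this[of k] less show ?thesis by simp
qed

theorem positive_on_characters_imp_mem:
  assumes f: "f \<in> A"
    and pos: "\<And>\<phi>. character \<phi> \<Longrightarrow> (\<And>a. a \<in> M \<Longrightarrow> \<phi> a \<ge> 0) \<Longrightarrow> \<phi> f > 0"
  shows "f \<in> M"
proof (rule positive_imp_SOS_multiple_ge_one[OF f])
  show "\<phi> f > 0" if "character \<phi>" "\<And>a. a \<in> M \<Longrightarrow> \<phi> a \<ge> 0" for \<phi>
    using that by (rule pos)
qed (rule SOS_multiple_ge_one_imp_mem[OF f])

end

section \<open>Bounded elements and root bounds\<close>

lemma sum_scaled_powers_le_half_power:
  fixes C D :: real
  assumes "m > 0" "C \<ge> 0" "D \<ge> 1" "2 * real m * C \<le> D"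
  shows "(\<Sum>k<m. C * D ^ k) \<le> D ^ m / 2"
proof -
  have "(\<Sum>k<m. C * D ^ k) \<le> (\<Sum>k<m. C * D ^ (m - 1))"
    using assms by (intro sum_mono mult_left_mono power_increasing) auto
  also have "\<dots> = real m * C * D ^ (m - 1)" by simp
  also have "\<dots> \<le> D / 2 * D ^ (m - 1)" using assms by (intro mult_right_mono) auto
  also have "\<dots> = D ^ m / 2" using \<open>m > 0\<close> by (simp add: power_eq_if)
  finally show ?thesis .
qed

context quadratic_module
begin

definition qm_bounded :: "('z \<Rightarrow> real) \<Rightarrow> bool" where
  "qm_bounded a \<longleftrightarrow> (\<exists>c. (\<lambda>_. - c) \<preceq> a \<and> a \<preceq> (\<lambda>_. c))"

lemma qm_boundedI:
  assumes lower: "(\<lambda>_. b) \<preceq> a" and upper: "a \<preceq> (\<lambda>_. c)"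
  shows "qm_bounded a"
  unfolding qm_bounded_def
proof (intro exI conjI)
  show "(\<lambda>_. - max c (- b)) \<preceq> a" by (rule qm_le_trans[OF qm_le_const lower]) simp
  show "a \<preceq> (\<lambda>_. max c (- b))" by (rule qm_le_trans[OF upper qm_le_const]) simp
qed

lemma qm_boundedE:
  assumes "qm_bounded a"
  obtains c where "c > 0" "(\<lambda>_. - c) \<preceq> a" "a \<preceq> (\<lambda>_. c)"
proof -
  obtain c where c: "(\<lambda>_. - c) \<preceq> a" "a \<preceq> (\<lambda>_. c)"
    using assms by (auto simp: qm_bounded_def)
  show ?thesis
  proof (rule that[of "max 1 c"])
    show "(\<lambda>_. - max 1 c) \<preceq> a" by (rule qm_le_trans[OF qm_le_const c(1)]) simp
    show "a \<preceq> (\<lambda>_. max 1 c)" by (rule qm_le_trans[OF c(2) qm_le_const]) simp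
  qed simp
qed

lemma qm_bounded_in_algebra:
  assumes "qm_bounded a"
  shows "a \<in> A"
proof -
  obtain c where "a \<preceq> (\<lambda>_. c)" using assms by (auto simp: qm_bounded_def)
  then have "(\<lambda>z. c - a z) \<in> A" using qm_subset by (auto simp: qm_le_def)
  from diff[OF const[of c] this] show ?thesis by simp
qed

lemma qm_bounded_const: "qm_bounded (\<lambda>_. c)"
  by (rule qm_boundedI) (rule qm_le_refl)+

lemma qm_bounded_add:
  assumes "qm_bounded a" "qm_bounded b"
  shows "qm_bounded (\<lambda>z. a z + b z)"
proof -
  obtain c d where "(\<lambda>_. - c) \<preceq> a" "a \<preceq> (\<lambda>_. c)" "(\<lambda>_. - d) \<preceq> b" "b \<preceq> (\<lambda>_. d)"
    using assms by (elim qm_boundedE)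
  then show ?thesis by (intro qm_boundedI[of "- c + - d" _ "c + d"] qm_le_add)
qed

lemma qm_bounded_minus:
  assumes "qm_bounded a"
  shows "qm_bounded (\<lambda>z. - a z)"
proof -
  obtain c where "(\<lambda>_. - c) \<preceq> a" "a \<preceq> (\<lambda>_. c)"
    using assms by (rule qm_boundedE)
  then show ?thesis by (intro qm_boundedI[of "- c" _ "- (- c)"] qm_le_minus)
qed

lemma qm_bounded_scale:
  assumes "qm_bounded a" "r \<ge> 0"
  shows "qm_bounded (\<lambda>z. r * a z)"
proof -
  obtain c where "(\<lambda>_. - c) \<preceq> a" "a \<preceq> (\<lambda>_. c)"
    using assms(1) by (rule qm_boundedE)
  then show ?thesis using assms(2) by (intro qm_boundedI[of "r * - c" _ "r * c"] qm_le_scale)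
qed

lemma qm_bounded_square:
  assumes a: "qm_bounded a"
  shows "qm_bounded (\<lambda>z. (a z)\<^sup>2)"
proof -
  obtain c where c: "c > 0" "(\<lambda>_. - c) \<preceq> a" "a \<preceq> (\<lambda>_. c)"
    using a by (rule qm_boundedE)
  show ?thesis
  proof (rule qm_boundedI)
    show "(\<lambda>_. 0) \<preceq> (\<lambda>z. (a z)\<^sup>2)"
      using qm_square[OF qm_bounded_in_algebra[OF a]] by (simp add: zero_qm_le_iff)
    show "(\<lambda>z. (a z)\<^sup>2) \<preceq> (\<lambda>_. c\<^sup>2)"
      using qm_bounded_in_algebra[OF a] c by (rule qm_le_square)
  qed
qed

lemma qm_bounded_mult:
  assumes "qm_bounded a" "qm_bounded b"
  shows "qm_bounded (\<lambda>z. a z * b z)"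
proof -
  have "qm_bounded (\<lambda>z. 1 / 4 * ((a z + b z)\<^sup>2 + - (a z + - b z)\<^sup>2))"
    by (intro qm_bounded_scale qm_bounded_add qm_bounded_minus qm_bounded_square assms) simp
  also have "(\<lambda>z. 1 / 4 * ((a z + b z)\<^sup>2 + - (a z + - b z)\<^sup>2)) = (\<lambda>z. a z * b z)"
    by (simp add: fun_eq_iff power2_eq_square algebra_simps)
  finally show ?thesis .
qed

lemma qm_bounded_if_square_qm_le:
  assumes a: "a \<in> A" and square_le: "(\<lambda>z. (a z)\<^sup>2) \<preceq> (\<lambda>_. c)"
  shows "qm_bounded a"
proof -
  have gap: "(\<lambda>z. c - (a z)\<^sup>2) \<in> M" using square_le by (simp add: qm_le_def)
  have "(\<lambda>z. 1 / 2 * ((c - (a z)\<^sup>2) + (1 + a z)\<^sup>2)) \<in> M"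
    "(\<lambda>z. 1 / 2 * ((c - (a z)\<^sup>2) + (1 - a z)\<^sup>2)) \<in> M"
    using a by (intro qm_scale qm_add[OF gap] qm_square closed; simp)+
  then show ?thesis
    by (intro qm_boundedI[of "- (c + 1) / 2" _ "(c + 1) / 2"];
        elim qm_leI) (simp_all add: field_simps power2_eq_square)
qed

text \<open>Here \<open>1 + u\<^sup>m - u\<^sup>k = (1 - u\<^sup>k) (1 - u\<^bsup>m-k\<^esup>) + u\<^bsup>m-k\<^esup>\<close>, whose first summand
  is \<open>(1 - u)\<^sup>2\<close> times a polynomial in \<open>u\<close> with nonnegative coefficients.\<close>

lemma SOS_power_qm_le:
  assumes u: "u \<in> SOS" and "k \<le> m"
  shows "(\<lambda>z. u z ^ k) \<preceq> (\<lambda>z. 1 + u z ^ m)"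
proof (rule qm_leI)
  have "(\<lambda>z. u z ^ i) \<in> M" for i
    using SOS_power[OF u] SOS_subset_qm by blast
  moreover have "u \<in> A" using u SOS_subset by blast
  ultimately show "(\<lambda>z. (1 - u z)\<^sup>2 * (\<Sum>i<k. \<Sum>j<m - k. u z ^ (i + j)) + u z ^ (m - k)) \<in> M"
    by (intro qm_add qm_square_mult qm_sum closed)
  fix z
  have "(1 - u z)\<^sup>2 * (\<Sum>i<k. \<Sum>j<m - k. u z ^ (i + j)) =
      ((1 - u z) * (\<Sum>i<k. u z ^ i)) * ((1 - u z) * (\<Sum>j<m - k. u z ^ j))"
    by (simp add: power_add power2_eq_square sum_product algebra_simps)
  also have "\<dots> = (1 - u z ^ k) * (1 - u z ^ (m - k))"
    by (simp only: one_diff_power_eq)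
  also have "\<dots> = 1 - u z ^ k - u z ^ (m - k) + u z ^ m"
    using \<open>k \<le> m\<close> by (simp add: algebra_simps flip: power_add)
  finally show "(1 - u z)\<^sup>2 * (\<Sum>i<k. \<Sum>j<m - k. u z ^ (i + j)) + u z ^ (m - k) =
      1 + u z ^ m - u z ^ k" by simp
qed

text \<open>For \<open>u = t / D\<close> with \<open>D\<close> large, the hypothesis and \<open>u\<^sup>k \<preceq> 1 + u\<^sup>m\<close> give
  \<open>u\<^sup>m \<preceq> (1 + u\<^sup>m) / 2\<close>.\<close>

lemma SOS_bounded_if_power_qm_le:
  assumes t: "t \<in> SOS" and m: "m > 0" and C: "C \<ge> 0"
    and power_le: "(\<lambda>z. t z ^ m) \<preceq> (\<lambda>z. C * (\<Sum>k<m. t z ^ k))"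
  shows "\<exists>c. t \<preceq> (\<lambda>_. c)"
proof -
  define D where "D = 2 * real m * C + 1"
  have D: "D \<ge> 1" using C by (simp add: D_def)
  define u where "u z = inverse D * t z" for z
  have u: "u \<in> SOS" unfolding u_def[abs_def] using D by (intro SOS_scale t) auto
  have t_eq: "t = (\<lambda>z. D * u z)" using D by (simp add: u_def fun_eq_iff)
  define E where "E = (\<Sum>k<m. C * D ^ k)"
  have E: "E \<le> D ^ m / 2"
    unfolding E_def using m C D by (intro sum_scaled_powers_le_half_power) (auto simp: D_def)
  have one_plus: "(\<lambda>z. 1 + u z ^ m) \<in> M"
    using SOS_power[OF u] SOS_subset_qm by (intro qm_add qm_one) auto
  have "(\<lambda>z. D ^ m * u z ^ m) \<preceq> (\<lambda>z. \<Sum>k<m. C * D ^ k * u z ^ k)"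
    using power_le by (simp add: t_eq power_mult_distrib sum_distrib_left mult.assoc)
  also have "\<dots> \<preceq> (\<lambda>z. \<Sum>k<m. C * D ^ k * (1 + u z ^ m))"
    using C D by (intro qm_le_sum qm_le_scale SOS_power_qm_le u) auto
  also have "\<dots> = (\<lambda>z. E * (1 + u z ^ m))"
    by (simp add: E_def sum_distrib_right)
  also have "\<dots> \<preceq> (\<lambda>z. D ^ m / 2 * (1 + u z ^ m))"
    using E by (intro qm_leI[OF qm_scale[OF one_plus, of "D ^ m / 2 - E"]])
      (simp_all add: left_diff_distrib)
  finally have "(\<lambda>z. 2 / D ^ m * (D ^ m / 2 * (1 + u z ^ m) - D ^ m * u z ^ m)) \<in> M"
    unfolding qm_le_def using D by (intro qm_scale) auto
  then have half: "(\<lambda>z. 1 + u z ^ m) \<preceq> (\<lambda>_. 2)"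
    by (rule qm_leI) (use D in \<open>simp add: field_simps\<close>)
  have "u \<preceq> (\<lambda>z. 1 + u z ^ m)"
    using SOS_power_qm_le[OF u, of 1 m] m by simp
  also note half
  finally have "t \<preceq> (\<lambda>_. D * 2)"
    unfolding t_eq using D by (intro qm_le_scale) auto
  then show ?thesis ..
qed

end

definition (in function_algebra) complexification :: "('z \<Rightarrow> complex) set" where
  "complexification = {F. (\<lambda>z. Re (F z)) \<in> A \<and> (\<lambda>z. Im (F z)) \<in> A}"

context function_algebra
begin

lemma complexification_of_real: "f \<in> A \<Longrightarrow> (\<lambda>z. complex_of_real (f z)) \<in> complexification"
  by (simp add: complexification_def const)

lemma complexification_const: "(\<lambda>_. c) \<in> complexification"
  by (simp add: complexification_def const)

lemma complexification_add:
  "F \<in> complexification \<Longrightarrow> G \<in> complexification \<Longrightarrow> (\<lambda>z. F z + G z) \<in> complexification"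
  by (simp add: complexification_def add)

lemma complexification_minus: "F \<in> complexification \<Longrightarrow> (\<lambda>z. - F z) \<in> complexification"
  by (simp add: complexification_def minus)

lemma complexification_mult:
  "F \<in> complexification \<Longrightarrow> G \<in> complexification \<Longrightarrow> (\<lambda>z. F z * G z) \<in> complexification"
  by (simp add: complexification_def closed)

lemma complexification_sum:
  "(\<And>i. i \<in> I \<Longrightarrow> F i \<in> complexification) \<Longrightarrow> (\<lambda>z. \<Sum>i\<in>I. F i z) \<in> complexification"
  by (induction I rule: infinite_finite_induct)
    (simp_all add: complexification_const complexification_add)

lemma complexification_prod:
  "(\<And>i. i \<in> I \<Longrightarrow> F i \<in> complexification) \<Longrightarrow> (\<lambda>z. \<Prod>i\<in>I. F i z) \<in> complexification"
  by (induction I rule: infinite_finite_induct)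
    (simp_all add: complexification_const complexification_mult)

lemma complexification_power:
  "F \<in> complexification \<Longrightarrow> (\<lambda>z. F z ^ k) \<in> complexification"
  by (induction k) (simp_all add: complexification_const complexification_mult)

lemmas complexification_closed = complexification_of_real complexification_const
  complexification_add complexification_minus complexification_mult complexification_sum
  complexification_prod complexification_power

lemma SOS_cmod_square: "F \<in> complexification \<Longrightarrow> (\<lambda>z. (cmod (F z))\<^sup>2) \<in> SOS"
  unfolding cmod_power2 by (auto simp: complexification_def intro: SOS.intros)

end

lemma sum_norm_diff_square:
  fixes f :: "'i \<Rightarrow> 'a::real_inner"
  shows "(\<Sum>i\<in>I. \<Sum>j\<in>I. (norm (f i - f j))\<^sup>2) =
    2 * (real (card I) * (\<Sum>i\<in>I. (norm (f i))\<^sup>2) - (norm (\<Sum>i\<in>I. f i))\<^sup>2)"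
proof -
  have "(\<Sum>i\<in>I. \<Sum>j\<in>I. (norm (f i - f j))\<^sup>2) =
      (\<Sum>i\<in>I. \<Sum>j\<in>I. (norm (f i))\<^sup>2 + (norm (f j))\<^sup>2 - 2 * (f i \<bullet> f j))"
    by (simp add: power2_norm_eq_inner inner_diff_left inner_diff_right inner_commute)
  also have "\<dots> = 2 * (real (card I) * (\<Sum>i\<in>I. (norm (f i))\<^sup>2)) - 2 * (\<Sum>i\<in>I. \<Sum>j\<in>I. f i \<bullet> f j)"
    by (simp add: sum.distrib sum_subtractf sum_distrib_left)
  also have "(\<Sum>i\<in>I. \<Sum>j\<in>I. f i \<bullet> f j) = (norm (\<Sum>i\<in>I. f i))\<^sup>2"
    unfolding power2_norm_eq_inner inner_sum_left inner_sum_right by (rule sum.swap)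
  finally show ?thesis by simp
qed

context quadratic_module
begin

text \<open>In the Cauchy--Schwarz inequality, Lagrange's identity exhibits the gap as a sum of squares.\<close>

lemma cmod_sum_square_qm_le:
  assumes F: "\<And>i. i \<in> I \<Longrightarrow> F i \<in> complexification"
  shows "(\<lambda>z. (cmod (\<Sum>i\<in>I. F i z))\<^sup>2) \<preceq> (\<lambda>z. real (card I) * (\<Sum>i\<in>I. (cmod (F i z))\<^sup>2))"
proof (rule qm_leI)
  have "(\<lambda>z. (cmod (F i z + - F j z))\<^sup>2) \<in> M" if "i \<in> I" "j \<in> I" for i j
    using that by (intro subsetD[OF SOS_subset_qm] SOS_cmod_square complexification_closed F)
  then show "(\<lambda>z. 1 / 2 * (\<Sum>i\<in>I. \<Sum>j\<in>I. (cmod (F i z - F j z))\<^sup>2)) \<in> M"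
    by (intro qm_scale qm_sum) auto
qed (simp add: sum_norm_diff_square)

definition complex_support :: "('z \<Rightarrow> complex) set" where
  "complex_support = {F. (\<lambda>z. Re (F z)) \<in> support \<and> (\<lambda>z. Im (F z)) \<in> support}"

lemma complex_support_add:
  "F \<in> complex_support \<Longrightarrow> G \<in> complex_support \<Longrightarrow> (\<lambda>z. F z + G z) \<in> complex_support"
  by (simp add: complex_support_def support_add)

lemma complex_support_sum:
  "(\<And>i. i \<in> I \<Longrightarrow> F i \<in> complex_support) \<Longrightarrow> (\<lambda>z. \<Sum>i\<in>I. F i z) \<in> complex_support"
proof (induction I rule: infinite_finite_induct)
  case (insert i I)
  then show ?case by (simp add: complex_support_add)
qed (simp_all add: complex_support_def support_def qm_const)

lemma complex_support_mult:
  assumes "F \<in> complex_support" "G \<in> complexification"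
  shows "(\<lambda>z. G z * F z) \<in> complex_support"
proof -
  have "(\<lambda>z. Re (G z) * Re (F z) + - (Im (G z) * Im (F z))) \<in> support"
    "(\<lambda>z. Re (G z) * Im (F z) + Im (G z) * Re (F z)) \<in> support"
    using assms unfolding complex_support_def complexification_def
    by (intro support_add support_minus support_mult; simp)+
  then show ?thesis by (simp add: complex_support_def)
qed

lemma cmod_diff_square_qm_le:
  assumes F: "F \<in> complex_support" and G: "G \<in> complexification"
  shows "(\<lambda>z. (cmod (F z - G z))\<^sup>2) \<preceq> (\<lambda>z. (cmod (G z))\<^sup>2)"
proof (rule qm_leI)
  have supp: "(\<lambda>z. Re (F z)) \<in> support" "(\<lambda>z. Im (F z)) \<in> support"
    using F by (auto simp: complex_support_def)
  then have "(\<lambda>z. Re (F z)) \<in> A" "(\<lambda>z. Im (F z)) \<in> A" "(\<lambda>z. Re (G z)) \<in> A" "(\<lambda>z. Im (G z)) \<in> A"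
    using G qm_subset by (auto simp: support_def complexification_def)
  then have "(\<lambda>z. (2 * Re (G z) - Re (F z)) * Re (F z) +
      (2 * Im (G z) - Im (F z)) * Im (F z)) \<in> support"
    by (intro support_add support_mult supp closed)
  then show "(\<lambda>z. (2 * Re (G z) - Re (F z)) * Re (F z) + (2 * Im (G z) - Im (F z)) * Im (F z)) \<in> M"
    by (simp add: support_def)
qed (simp add: cmod_power2, simp add: power2_eq_square algebra_simps)

theorem cmod_square_bounded_if_monic_root:
  assumes s: "s \<in> complexification" and b: "\<And>k. k < m \<Longrightarrow> b k \<in> complexification"
    and b_bounded: "\<And>k. k < m \<Longrightarrow> \<exists>c. (\<lambda>z. (cmod (b k z))\<^sup>2) \<preceq> (\<lambda>_. c)"
    and m: "m > 0" and root: "(\<lambda>z. s z ^ m + (\<Sum>k<m. b k z * s z ^ k)) \<in> complex_support"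
  shows "\<exists>c. (\<lambda>z. (cmod (s z))\<^sup>2) \<preceq> (\<lambda>_. c)"
proof -
  define t where "t z = (cmod (s z))\<^sup>2" for z
  have t: "t \<in> SOS" unfolding t_def[abs_def] by (rule SOS_cmod_square[OF s])
  have t_power: "(cmod (s z ^ k))\<^sup>2 = t z ^ k" for z k
    by (simp add: t_def norm_power mult.commute flip: power_mult)
  obtain c where c: "\<And>k. k < m \<Longrightarrow> (\<lambda>z. (cmod (b k z))\<^sup>2) \<preceq> (\<lambda>_. c k)"
    using b_bounded by metis
  define C where "C = (\<Sum>k<m. \<bar>c k\<bar>)"
  have C: "C \<ge> 0" "\<And>k. k < m \<Longrightarrow> c k \<le> C"
    unfolding C_def
    by (auto intro!: sum_nonneg order_trans[OF abs_ge_self member_le_sum[of _ _ "\<lambda>k. \<bar>c k\<bar>"]])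
  have terms: "(\<lambda>z. b k z * s z ^ k) \<in> complexification" if "k < m" for k
    using that by (intro complexification_closed b s)
  have "(\<lambda>z. \<Sum>k<m. b k z * s z ^ k) \<in> complexification"
    using terms by (intro complexification_sum) auto
  from cmod_diff_square_qm_le[OF root this]
  have "(\<lambda>z. t z ^ m) \<preceq> (\<lambda>z. (cmod (\<Sum>k<m. b k z * s z ^ k))\<^sup>2)"
    by (simp add: t_power)
  also have "\<dots> \<preceq> (\<lambda>z. real m * (\<Sum>k<m. (cmod (b k z * s z ^ k))\<^sup>2))"
    using cmod_sum_square_qm_le[of "{..<m}" "\<lambda>k z. b k z * s z ^ k"] terms by simp
  also have "\<dots> = (\<lambda>z. real m * (\<Sum>k<m. t z ^ k * (cmod (b k z))\<^sup>2))"
    by (simp add: norm_mult power_mult_distrib t_power mult.commute)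
  also have "\<dots> \<preceq> (\<lambda>z. real m * (\<Sum>k<m. t z ^ k * C))"
    by (intro qm_le_scale qm_le_sum qm_le_SOS_mult SOS_power t qm_le_trans[OF c qm_le_const])
      (auto simp: C)
  also have "\<dots> = (\<lambda>z. real m * C * (\<Sum>k<m. t z ^ k))"
    by (simp add: sum_distrib_left sum_distrib_right mult_ac)
  finally have "\<exists>c. t \<preceq> (\<lambda>_. c)"
    by (rule SOS_bounded_if_power_qm_le[OF t m, rotated]) (simp add: C)
  then show ?thesis by (simp add: t_def[abs_def])
qed

end

section \<open>Polynomial functions\<close>

definition monomial :: "nat \<Rightarrow> (nat \<Rightarrow> nat) \<Rightarrow> (nat \<Rightarrow> real) \<Rightarrow> real" where
  "monomial N \<alpha> z = (\<Prod>i<N. z i ^ \<alpha> i)"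

lemma poly_fun_iff:
  "poly_fun N k f \<longleftrightarrow> (\<exists>c. f = (\<lambda>z. \<Sum>\<alpha>\<in>mono_set N k. c \<alpha> * monomial N \<alpha> z))"
  by (simp add: poly_fun_def monomial_def fun_eq_iff)

lemma finite_mono_set: "finite (mono_set N k)"
proof (rule finite_subset)
  let ?extend = "\<lambda>f i. if i < N then f i else 0"
  show "finite (?extend ` PiE {..<N} (\<lambda>_. {..nat k}))"
    by (intro finite_imageI finite_PiE) auto
  show "mono_set N k \<subseteq> ?extend ` PiE {..<N} (\<lambda>_. {..nat k})"
  proof
    fix \<alpha> assume \<alpha>: "\<alpha> \<in> mono_set N k"
    have "\<alpha> i \<le> nat k" if "i < N" for i
      using member_le_sum[of i "{..<N}" \<alpha>] that \<alpha> by (auto simp: mono_set_def simp del: of_nat_sum)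
    then have "restrict \<alpha> {..<N} \<in> PiE {..<N} (\<lambda>_. {..nat k})" by auto
    moreover have "\<alpha> = ?extend (restrict \<alpha> {..<N})" using \<alpha> by (auto simp: mono_set_def)
    ultimately show "\<alpha> \<in> ?extend ` PiE {..<N} (\<lambda>_. {..nat k})" by blast
  qed
qed

lemma poly_fun_zero: "poly_fun N k (\<lambda>_. 0)"
  unfolding poly_fun_iff by (intro exI[of _ "\<lambda>_. 0"]) simp

lemma poly_fun_add:
  assumes "poly_fun N k f" "poly_fun N k g"
  shows "poly_fun N k (\<lambda>z. f z + g z)"
proof -
  obtain c d where "f = (\<lambda>z. \<Sum>\<alpha>\<in>mono_set N k. c \<alpha> * monomial N \<alpha> z)"
    "g = (\<lambda>z. \<Sum>\<alpha>\<in>mono_set N k. d \<alpha> * monomial N \<alpha> z)"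
    using assms by (auto simp: poly_fun_iff)
  then show ?thesis
    unfolding poly_fun_iff
    by (intro exI[of _ "\<lambda>\<alpha>. c \<alpha> + d \<alpha>"]) (simp add: distrib_right sum.distrib)
qed

lemma poly_fun_scale:
  assumes "poly_fun N k f"
  shows "poly_fun N k (\<lambda>z. r * f z)"
proof -
  obtain c where "f = (\<lambda>z. \<Sum>\<alpha>\<in>mono_set N k. c \<alpha> * monomial N \<alpha> z)"
    using assms by (auto simp: poly_fun_iff)
  then show ?thesis
    unfolding poly_fun_iff
    by (intro exI[of _ "\<lambda>\<alpha>. r * c \<alpha>"]) (simp add: sum_distrib_left mult.assoc)
qed

lemma poly_fun_sum: "(\<And>i. i \<in> I \<Longrightarrow> poly_fun N k (f i)) \<Longrightarrow> poly_fun N k (\<lambda>z. \<Sum>i\<in>I. f i z)"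
  by (induction I rule: infinite_finite_induct) (simp_all add: poly_fun_zero poly_fun_add)

lemma poly_fun_monomial:
  assumes "\<alpha> \<in> mono_set N k"
  shows "poly_fun N k (monomial N \<alpha>)"
  unfolding poly_fun_iff
  using assms
  by (intro exI[of _ "\<lambda>\<beta>. of_bool (\<beta> = \<alpha>)"])
    (simp add: finite_mono_set of_bool_def if_distrib[of "\<lambda>x. x * _"] cong: if_cong)

lemma poly_fun_mono:
  assumes "poly_fun N k f" "N \<le> N'" "k \<le> k'"
  shows "poly_fun N' k' f"
proof -
  obtain c where f: "f = (\<lambda>z. \<Sum>\<alpha>\<in>mono_set N k. c \<alpha> * monomial N \<alpha> z)"
    using assms(1) by (auto simp: poly_fun_iff)
  have "poly_fun N' k' (monomial N \<alpha>)" if \<alpha>: "\<alpha> \<in> mono_set N k" for \<alpha>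
  proof -
    have "sum \<alpha> {..<N'} = sum \<alpha> {..<N}"
      using \<alpha> assms(2) by (intro sum.mono_neutral_right) (auto simp: mono_set_def)
    then have "\<alpha> \<in> mono_set N' k'"
      using \<alpha> assms by (auto simp: mono_set_def simp del: of_nat_sum)
    moreover have "monomial N' \<alpha> = monomial N \<alpha>"
      using \<alpha> assms(2) unfolding monomial_def[abs_def]
      by (intro ext prod.mono_neutral_right) (auto simp: mono_set_def)
    ultimately show ?thesis using poly_fun_monomial by metis
  qed
  then show ?thesis unfolding f by (intro poly_fun_sum poly_fun_scale)
qed

lemma poly_fun_mult:
  assumes "poly_fun N k f" "poly_fun N l g"
  shows "poly_fun N (k + l) (\<lambda>z. f z * g z)"
proof -
  obtain c d where f: "f = (\<lambda>z. \<Sum>\<alpha>\<in>mono_set N k. c \<alpha> * monomial N \<alpha> z)"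
    and g: "g = (\<lambda>z. \<Sum>\<alpha>\<in>mono_set N l. d \<alpha> * monomial N \<alpha> z)"
    using assms by (auto simp: poly_fun_iff)
  have "poly_fun N (k + l) (\<lambda>z. monomial N \<alpha> z * monomial N \<beta> z)"
    if "\<alpha> \<in> mono_set N k" "\<beta> \<in> mono_set N l" for \<alpha> \<beta>
  proof -
    have "(\<lambda>i. \<alpha> i + \<beta> i) \<in> mono_set N (k + l)"
      using that by (auto simp: mono_set_def sum.distrib)
    from poly_fun_monomial[OF this] show ?thesis
      by (simp add: monomial_def[abs_def] power_add prod.distrib)
  qed
  then have "poly_fun N (k + l) (\<lambda>z. \<Sum>\<alpha>\<in>mono_set N k. \<Sum>\<beta>\<in>mono_set N l.
      (c \<alpha> * d \<beta>) * (monomial N \<alpha> z * monomial N \<beta> z))"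
    by (intro poly_fun_sum poly_fun_scale)
  then show ?thesis unfolding f g by (simp add: sum_product mult_ac)
qed

lemma poly_fun_const:
  assumes "k \<ge> 0"
  shows "poly_fun N k (\<lambda>_. c)"
  using poly_fun_scale[OF poly_fun_monomial[of "\<lambda>_. 0" N k], of c] assms
  by (simp add: mono_set_def monomial_def)

lemma poly_fun_coordinate:
  assumes "i < N"
  shows "poly_fun N 1 (\<lambda>z. z i)"
proof -
  let ?\<alpha> = "\<lambda>j. of_bool (j = i) :: nat"
  have "?\<alpha> \<in> mono_set N 1"
    using assms by (auto simp: mono_set_def of_bool_def simp del: of_nat_sum)
  moreover have "monomial N ?\<alpha> = (\<lambda>z. z i)"
  proof
    fix z
    have "monomial N ?\<alpha> z = (\<Prod>j\<in>{i}. z j ^ ?\<alpha> j)"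
      unfolding monomial_def using assms by (intro prod.mono_neutral_right) auto
    then show "monomial N ?\<alpha> z = z i" by simp
  qed
  ultimately show ?thesis using poly_fun_monomial by metis
qed

definition polys :: "nat \<Rightarrow> ((nat \<Rightarrow> real) \<Rightarrow> real) set" where
  "polys N = {f. \<exists>k. poly_fun N k f}"

global_interpretation polys: function_algebra "polys N" for N
proof
  show "(\<lambda>_. c) \<in> polys N" for c
    using poly_fun_const[of 0] by (auto simp: polys_def)
next
  fix f g assume "f \<in> polys N" "g \<in> polys N"
  then obtain k l where kl: "poly_fun N k f" "poly_fun N l g" by (auto simp: polys_def)
  then have "poly_fun N (max k l) f" "poly_fun N (max k l) g" by (auto elim: poly_fun_mono)
  then show "(\<lambda>z. f z + g z) \<in> polys N" by (auto simp: polys_def intro: poly_fun_add)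
  show "(\<lambda>z. f z * g z) \<in> polys N" using poly_fun_mult[OF kl] by (auto simp: polys_def)
qed

lemma polys_coordinate: "i < N \<Longrightarrow> (\<lambda>z. z i) \<in> polys N"
  using poly_fun_coordinate by (auto simp: polys_def)

lemma polys_mono: "N \<le> N' \<Longrightarrow> polys N \<subseteq> polys N'"
  using poly_fun_mono[OF _ _ order_refl] unfolding polys_def by blast

lemma polys_induct [consumes 1, case_names const coordinate add mult]:
  assumes f: "f \<in> polys N"
    and const: "\<And>c. P (\<lambda>_. c)"
    and coordinate: "\<And>i. i < N \<Longrightarrow> P (\<lambda>z. z i)"
    and add: "\<And>f g. f \<in> polys N \<Longrightarrow> g \<in> polys N \<Longrightarrow> P f \<Longrightarrow> P g \<Longrightarrow> P (\<lambda>z. f z + g z)"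
    and mult: "\<And>f g. f \<in> polys N \<Longrightarrow> g \<in> polys N \<Longrightarrow> P f \<Longrightarrow> P g \<Longrightarrow> P (\<lambda>z. f z * g z)"
  shows "P f"
proof -
  interpret P: function_algebra "{f \<in> polys N. P f}"
    by standard (auto intro: polys.closed const add mult)
  obtain k c where f: "f = (\<lambda>z. \<Sum>\<alpha>\<in>mono_set N k. c \<alpha> * monomial N \<alpha> z)"
    using f by (auto simp: polys_def poly_fun_iff)
  have "f \<in> {f \<in> polys N. P f}"
    unfolding f monomial_def
    by (intro P.sum P.scale P.prod P.power) (auto intro: polys_coordinate coordinate)
  then show ?thesis by simp
qed

lemma polys_cong: "f \<in> polys N \<Longrightarrow> (\<And>i. i < N \<Longrightarrow> z i = z' i) \<Longrightarrow> f z = f z'"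
  by (induction rule: polys_induct) auto

lemma continuous_on_polys: "f \<in> polys N \<Longrightarrow> continuous_on S f"
proof (induction rule: polys_induct)
  case (coordinate i)
  show ?case by (rule continuous_on_subset[OF continuous_on_product_coordinates]) simp
qed (auto intro: continuous_intros)

lemma character_polys_eq_evaluation:
  assumes "polys.character N \<phi>" "f \<in> polys N"
  shows "\<phi> f = f (\<lambda>i. \<phi> (\<lambda>z. z i))"
  using assms(2,1) by (induction rule: polys_induct) (auto simp: polys.character_def)

theorem putinar:
  assumes "archimedean_module (polys N) M" and f: "f \<in> polys N"
    and pos: "\<And>z. (\<And>g. g \<in> M \<Longrightarrow> g z \<ge> 0) \<Longrightarrow> f z > 0"
  shows "f \<in> M"
proof -
  interpret archimedean_module "polys N" M by fact
  show ?thesis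
  proof (rule positive_on_characters_imp_mem[OF f])
    fix \<phi> assume \<phi>: "polys.character N \<phi>" and nonneg: "\<And>g. g \<in> M \<Longrightarrow> \<phi> g \<ge> 0"
    have evaluation: "\<phi> g = g (\<lambda>i. \<phi> (\<lambda>z. z i))" if "g \<in> polys N" for g
      using \<phi> that by (rule character_polys_eq_evaluation)
    have "f (\<lambda>i. \<phi> (\<lambda>z. z i)) > 0"
      using nonneg evaluation qm_subset by (intro pos) force
    then show "\<phi> f > 0" by (simp add: evaluation[OF f])
  qed
qed

lemma sos_mono: "sos N k f \<Longrightarrow> k \<le> k' \<Longrightarrow> sos N k' f"
  using poly_fun_mono unfolding sos_def by blast

lemma sos_zero: "sos N k (\<lambda>_. 0)"
  unfolding sos_def by (intro exI[of _ "[]"]) auto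

lemma sos_one: "k \<ge> 0 \<Longrightarrow> sos N k (\<lambda>_. 1)"
  unfolding sos_def by (intro exI[of _ "[\<lambda>_. 1]"]) (auto intro: poly_fun_const)

lemma sos_add:
  assumes "sos N k f" "sos N k g"
  shows "sos N k (\<lambda>z. f z + g z)"
proof -
  obtain fs gs where "\<forall>h\<in>set fs. poly_fun N k h" "\<forall>z. f z = (\<Sum>h\<leftarrow>fs. (h z)\<^sup>2)"
    "\<forall>h\<in>set gs. poly_fun N k h" "\<forall>z. g z = (\<Sum>h\<leftarrow>gs. (h z)\<^sup>2)"
    using assms by (auto simp: sos_def)
  then show ?thesis unfolding sos_def by (intro exI[of _ "fs @ gs"]) auto
qed

lemma sos_square_mult:
  assumes "sos N k f" and g: "poly_fun N e g"
  shows "sos N (k + e) (\<lambda>z. (g z)\<^sup>2 * f z)"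
proof -
  obtain fs where fs: "\<forall>h\<in>set fs. poly_fun N k h" "\<forall>z. f z = (\<Sum>h\<leftarrow>fs. (h z)\<^sup>2)"
    using assms(1) by (auto simp: sos_def)
  let ?gs = "map (\<lambda>h z. h z * g z) fs"
  have "\<forall>h\<in>set ?gs. poly_fun N (k + e) h"
    using fs(1) g by (auto intro: poly_fun_mult)
  moreover have "(g z)\<^sup>2 * f z = (\<Sum>h\<leftarrow>?gs. (h z)\<^sup>2)" for z
    using fs(2) by (simp add: o_def power_mult_distrib sum_list_mult_const mult.commute)
  ultimately show ?thesis unfolding sos_def by blast
qed

lemma sos_nonneg: "sos N k f \<Longrightarrow> f z \<ge> 0"
  by (auto simp: sos_def intro!: sum_list_nonneg)

lemma sos_imp_polys: "sos N k f \<Longrightarrow> f \<in> polys N"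
proof -
  have "(\<forall>g\<in>set gs. g \<in> polys N) \<Longrightarrow> (\<lambda>z. \<Sum>g\<leftarrow>gs. (g z)\<^sup>2) \<in> polys N" for gs
    by (induction gs) (auto intro: polys.closed)
  then show "sos N k f \<Longrightarrow> f \<in> polys N"
    unfolding sos_def polys_def fun_eq_iff[symmetric] by auto
qed

section \<open>Roots of real polynomials\<close>

lemma vieta:
  fixes s :: "'i \<Rightarrow> 'a::comm_ring_1"
  assumes "finite I"
  shows "(\<Prod>l\<in>I. X - s l) =
    (\<Sum>k\<le>card I. (-1) ^ k * (\<Sum>S\<in>{S. S \<subseteq> I \<and> card S = k}. \<Prod>l\<in>S. s l) * X ^ (card I - k))"
proof -
  have "(\<Prod>l\<in>I. X - s l) = (\<Sum>S\<in>Pow I. (-1) ^ card S * (\<Prod>l\<in>S. s l) * X ^ (card I - card S))"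
    using assms
    by (subst prod_diff_conv_sum) (auto simp: card_Diff_subset finite_subset intro!: sum.cong)
  also have "\<dots> = (\<Sum>k\<le>card I. \<Sum>S\<in>{S \<in> Pow I. card S = k}.
      (-1) ^ card S * (\<Prod>l\<in>S. s l) * X ^ (card I - card S))"
    using assms by (intro sum.group[symmetric]) (auto intro: card_mono)
  also have "\<dots> = (\<Sum>k\<le>card I. (-1) ^ k * (\<Sum>S\<in>{S. S \<subseteq> I \<and> card S = k}. \<Prod>l\<in>S. s l) * X ^ (card I - k))"
    by (intro sum.cong refl) (simp add: sum_distrib_left sum_distrib_right)
  finally show ?thesis .
qed

lemma proots_prod_linear: "proots (\<Prod>x\<in>#A. [:- x, 1:]) = (A :: 'a::idom multiset)"
proof (induction A)
  case (add x A)
  have "(\<Prod>x\<in>#A. [:- x, 1:]) \<noteq> (0 :: 'a poly)" by (auto simp: prod_mset_zero_iff)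
  then show ?case using add by (simp add: proots_mult del: mult_pCons_left)
qed simp

lemma poly_prod_linear: "poly (\<Prod>x\<in>#A. [:- x, 1:]) X = (\<Prod>x\<in>#A. X - x)"
  for X :: "'a::comm_ring_1"
  by (induction A) (auto simp: algebra_simps)

definition cnj_invariant :: "complex multiset \<Rightarrow> bool" where
  "cnj_invariant A \<longleftrightarrow> image_mset cnj A = A"

lemma cnj_invariant_proots:
  assumes real: "\<And>i. coeff P i \<in> \<real>"
  shows "cnj_invariant (proots P)"
proof (cases "P = 0")
  case False
  define L where "L A = smult (lead_coeff P) (\<Prod>x\<in>#A. [:- x, 1:])" for A
  have decompose: "L (proots P) = P"
    unfolding L_def by (rule complex_poly_decompose_multiset)
  have cnj_lead: "cnj (lead_coeff P) = lead_coeff P"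
    using real by (simp add: Reals_cnj_iff)
  have "poly (\<Prod>x\<in>#image_mset cnj A. [:- x, 1:]) X = cnj (poly (\<Prod>x\<in>#A. [:- x, 1:]) (cnj X))" for A X
    unfolding poly_prod_linear by (induction A) auto
  then have "poly (L (image_mset cnj (proots P))) X = cnj (poly (L (proots P)) (cnj X))" for X
    unfolding L_def poly_smult complex_cnj_mult cnj_lead by (simp only:)
  also have "cnj (poly (L (proots P)) (cnj X)) = poly P X" for X
    using poly_cnj_real[OF real, of "cnj X"] by (simp add: decompose)
  finally have "L (image_mset cnj (proots P)) = P"
    by (intro poly_eq_poly_eq_iff[THEN iffD1] ext)
  moreover have "proots (L A) = A" for A
    using False by (simp add: L_def proots_prod_linear)
  ultimately show ?thesis unfolding cnj_invariant_def by metis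
qed (simp add: cnj_invariant_def)

lemma cnj_invariant_add_real_iff:
  assumes "Im s = 0"
  shows "cnj_invariant (add_mset s B) \<longleftrightarrow> cnj_invariant B"
proof -
  have "cnj s = s" using assms by (simp add: complex_eq_iff)
  then show ?thesis by (simp add: cnj_invariant_def)
qed

lemma cnj_invariant_add_nonreal:
  assumes inv: "cnj_invariant (add_mset s B)" and "Im s \<noteq> 0"
  obtains C where "B = add_mset (cnj s) C" "cnj_invariant C"
proof -
  have "cnj s \<in># image_mset cnj (add_mset s B)" by simp
  then have "cnj s \<in># add_mset s B"
    using inv unfolding cnj_invariant_def by metis
  moreover have "cnj s \<noteq> s" using assms(2) by (simp add: complex_eq_iff)
  ultimately have "cnj s \<in># B" by simp
  then obtain C where C: "B = add_mset (cnj s) C" by (rule multi_member_split[THEN exE])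
  then have "cnj_invariant C"
    using inv by (simp add: cnj_invariant_def add_mset_commute)
  with C show ?thesis by (rule that)
qed

lemma cnj_invariant_odd_size_real:
  assumes "cnj_invariant A" "odd (size A)"
  shows "\<exists>r B. A = add_mset r B \<and> Im r = 0"
  using assms
proof (induction "size A" arbitrary: A rule: less_induct)
  case less
  then obtain s B where A: "A = add_mset s B" by (cases A) auto
  show ?case
  proof (cases "Im s = 0")
    case False
    obtain C where B: "B = add_mset (cnj s) C" "cnj_invariant C"
      using cnj_invariant_add_nonreal[OF _ False] less.prems(1) A by blast
    then obtain r D where "C = add_mset r D" "Im r = 0"
      using less.hyps[of C] less.prems(2) A by auto
    then have "A = add_mset r (add_mset s (add_mset (cnj s) D))" "Im r = 0"
      using A B(1) by (simp_all add: add_mset_commute)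
    then show ?thesis by blast
  qed (use A in blast)
qed

lemma cnj_invariant_opposite:
  assumes inv: "cnj_invariant (add_mset s B)" and "odd (size B)"
  obtains t C where "B = add_mset t C" "Im t = - Im s" "cnj_invariant C"
proof (cases "Im s = 0")
  case True
  then have B: "cnj_invariant B" using inv by (simp add: cnj_invariant_add_real_iff)
  then obtain t C where "B = add_mset t C" "Im t = 0"
    using cnj_invariant_odd_size_real assms(2) by blast
  then show ?thesis using that True B cnj_invariant_add_real_iff by simp
next
  case False
  then obtain C where "B = add_mset (cnj s) C" "cnj_invariant C"
    using cnj_invariant_add_nonreal[OF inv] by blast
  then show ?thesis using that by simp
qed

lemma cnj_invariant_balancing_pair:
  assumes inv: "cnj_invariant (add_mset a B)" and "even (size B)" "B \<noteq> {#}"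
  obtains b d C where "B = add_mset b (add_mset d C)" "Im b + Im d + Im a = 0" "cnj_invariant C"
proof (cases "Im a = 0")
  case True
  obtain b B' where B: "B = add_mset b B'" using assms(3) by (cases B) auto
  have "cnj_invariant (add_mset b B')"
    using inv True by (simp add: cnj_invariant_add_real_iff flip: B)
  moreover have "odd (size B')" using assms(2) B by simp
  ultimately obtain d C where "B' = add_mset d C" "Im d = - Im b" "cnj_invariant C"
    by (rule cnj_invariant_opposite)
  then show ?thesis using that B True by simp
next
  case False
  then obtain B' where B: "B = add_mset (cnj a) B'" "cnj_invariant B'"
    using cnj_invariant_add_nonreal[OF inv] by blast
  then obtain d C where "B' = add_mset d C" "Im d = 0"
    using cnj_invariant_odd_size_real[of B'] assms(2) by auto
  then show ?thesis using that B cnj_invariant_add_real_iff by simp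
qed

fun paired :: "complex list \<Rightarrow> bool" where
  "paired [] \<longleftrightarrow> True"
| "paired [x] \<longleftrightarrow> False"
| "paired (x # y # xs) \<longleftrightarrow> Im x = - Im y \<and> paired xs"

lemma paired_append: "paired xs \<Longrightarrow> paired ys \<Longrightarrow> paired (xs @ ys)"
  by (induction xs rule: paired.induct) auto

lemma even_length_paired: "paired xs \<Longrightarrow> even (length xs)"
  by (induction xs rule: paired.induct) auto

lemma paired_nth:
  "paired xs \<Longrightarrow> 2 * i + 1 < length xs \<Longrightarrow> Im (xs ! (2 * i)) = - Im (xs ! (2 * i + 1))"
proof (induction xs arbitrary: i rule: paired.induct)
  case (3 x y xs)
  then show ?case by (cases i) auto
qed auto

lemma cnj_invariant_paired_enumeration:
  assumes "cnj_invariant A" "even (size A)"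
  shows "\<exists>xs. mset xs = A \<and> paired xs"
  using assms
proof (induction "size A" arbitrary: A rule: less_induct)
  case less
  show ?case
  proof (cases A)
    case empty
    then show ?thesis by (intro exI[of _ "[]"]) simp
  next
    case (add s B)
    then have "odd (size B)" using less.prems(2) by simp
    then obtain t C where C: "B = add_mset t C" "Im t = - Im s" "cnj_invariant C"
      using cnj_invariant_opposite less.prems(1) add by blast
    then obtain xs where "mset xs = C" "paired xs"
      using less.hyps[of C] less.prems(2) add by auto
    then show ?thesis using add C by (intro exI[of _ "s # t # xs"]) simp
  qed
qed

definition yfull_admissible :: "complex list \<Rightarrow> bool" where
  "yfull_admissible xs \<longleftrightarrow> (\<exists>yt. \<forall>l\<in>{1..length xs}. Im (xs ! (l - 1)) = yfull (length xs) yt l)"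

lemma yfull_admissible_paired:
  assumes xs: "paired xs"
  shows "yfull_admissible xs"
  unfolding yfull_admissible_def
proof (intro exI ballI)
  fix l assume l: "l \<in> {1..length xs}"
  have even: "even (length xs)" using xs by (rule even_length_paired)
  show "Im (xs ! (l - 1)) = yfull (length xs) (\<lambda>j. Im (xs ! (2 * j + 1))) l"
  proof (cases "even l")
    case True
    then obtain j where "l = 2 * j" by (rule evenE)
    with l obtain i where "l = 2 * i + 2" by (cases j) auto
    then show ?thesis using even by (simp add: yfull_def)
  next
    case False
    then obtain i where i: "l = 2 * i + 1" by (rule oddE)
    moreover have "l \<noteq> length xs" using False even by blast
    ultimately show ?thesis using paired_nth[OF xs, of i] l even by (simp add: yfull_def)
  qed
qed

lemma yfull_admissible_odd:
  assumes xs: "paired xs" and sum: "Im b + Im d + Im a = 0"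
  shows "yfull_admissible (xs @ [b, d, a])"
  unfolding yfull_admissible_def
proof (intro exI ballI)
  obtain i0 where i0: "length xs = 2 * i0" using even_length_paired[OF xs] by (rule evenE)
  let ?xs = "xs @ [b, d, a]"
  let ?yt = "\<lambda>j. if j = Suc (length xs div 2) then Im a else Im (?xs ! (2 * j + 1))"
  fix l assume l: "l \<in> {1..length ?xs}"
  then consider (last) "l = 2 * i0 + 3" | (second_last) "l = 2 * i0 + 2"
    | (third_last) "l = 2 * i0 + 1" | (front) "l \<le> 2 * i0"
    using i0 by fastforce
  then show "Im (?xs ! (l - 1)) = yfull (length ?xs) ?yt l"
  proof cases
    case front
    show ?thesis
    proof (cases "even l")
      case True
      then obtain j where "l = 2 * j" by (rule evenE)
      with l obtain i where "l = 2 * i + 2" by (cases j) auto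
      then show ?thesis using i0 front by (simp add: yfull_def)
    next
      case False
      then obtain i where i: "l = 2 * i + 1" by (rule oddE)
      then have less: "2 * i + 1 < length xs" using front i0 by presburger
      from paired_nth[OF xs less] show ?thesis
        using i i0 less by (simp add: yfull_def nth_append)
    qed
  qed (use i0 sum in \<open>auto simp: yfull_def nth_append nth_Cons'\<close>)
qed

lemma cnj_invariant_admissible_enumeration:
  assumes inv: "cnj_invariant (add_mset a B)"
  obtains xs where "mset xs = B" "yfull_admissible (xs @ [a])"
proof -
  consider (odd) "odd (size B)" | (empty) "B = {#}" | (even) "even (size B)" "B \<noteq> {#}" by blast
  then show ?thesis
  proof cases
    case odd
    then obtain t C where C: "B = add_mset t C" "Im t = - Im a" "cnj_invariant C"
      using cnj_invariant_opposite[OF inv] by blast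
    then obtain xs where xs: "mset xs = C" "paired xs"
      using cnj_invariant_paired_enumeration[of C] odd by auto
    then have "paired (xs @ [t, a])" using C(2) by (intro paired_append) auto
    then show ?thesis using that[of "xs @ [t]"] xs(1) C(1) yfull_admissible_paired by simp
  next
    case empty
    have "yfull_admissible [a]"
      unfolding yfull_admissible_def by (intro exI[of _ "\<lambda>_. Im a"]) (simp add: yfull_def)
    then show ?thesis using that[of "[]"] empty by simp
  next
    case even
    then obtain b d C where C: "B = add_mset b (add_mset d C)" "Im b + Im d + Im a = 0"
      "cnj_invariant C"
      using cnj_invariant_balancing_pair[OF inv] by blast
    then obtain xs where "mset xs = C" "paired xs"
      using cnj_invariant_paired_enumeration[of C] even by auto
    then show ?thesis
      using that[of "xs @ [b, d]"] C(1) yfull_admissible_odd[OF _ C(2), of xs] by simp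
  qed
qed

lemma poly_eq_prod_enumerated_roots:
  fixes P :: "complex poly"
  assumes "lead_coeff P = 1" and xs: "mset xs = proots P"
  shows "poly P X = (\<Prod>l\<in>{1..length xs}. X - xs ! (l - 1))"
proof -
  have "poly P X = (\<Prod>x\<in>#proots P. X - x)"
    using complex_poly_decompose_multiset[of P] poly_prod_linear[of "proots P" X] assms(1) by simp
  also have "\<dots> = prod_list (map (\<lambda>x. X - x) xs)"
    by (simp flip: xs prod_mset_prod_list)
  also have "\<dots> = (\<Prod>i<length xs. X - xs ! i)"
    by (simp add: prod.list_conv_set_nth atLeast0LessThan)
  also have "\<dots> = (\<Prod>l\<in>{1..length xs}. X - xs ! (l - 1))"
    by (rule prod.reindex_bij_witness[of _ "\<lambda>l. l - 1" Suc]) auto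
  finally show ?thesis .
qed

lemma dominant_root_admissible_enumeration:
  assumes real: "\<And>i. coeff P i \<in> \<real>" and "degree P > 0"
  obtains xs a where "mset (xs @ [a]) = proots P" "yfull_admissible (xs @ [a])"
    "\<And>x. x \<in># proots P \<Longrightarrow> Re x \<le> Re a"
proof -
  have "set_mset (proots P) \<noteq> {}"
    using assms(2) by (auto simp flip: size_proots_complex)
  then obtain a where a: "a \<in># proots P" and Max: "Max (Re ` set_mset (proots P)) = Re a"
    using obtains_MAX[OF finite_set_mset] by metis
  obtain B where B: "proots P = add_mset a B" using a by (rule multi_member_split[THEN exE])
  have "cnj_invariant (add_mset a B)"
    unfolding B[symmetric] using real by (rule cnj_invariant_proots)
  then obtain xs where "mset xs = B" "yfull_admissible (xs @ [a])"
    by (rule cnj_invariant_admissible_enumeration)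
  moreover have "Re x \<le> Re a" if "x \<in># proots P" for x
    using that by (simp flip: Max)
  ultimately show ?thesis by (intro that[of xs a]) (simp_all add: B)
qed

lemma root_arrangement:
  fixes c :: "nat \<Rightarrow> real"
  assumes m: "m \<ge> 1" and monic: "c m = 1"
  obtains s yt where "\<And>X. (\<Sum>k\<le>m. complex_of_real (c k) * X ^ k) = (\<Prod>l\<in>{1..m}. X - s l)"
    "\<And>l. l \<in> {1..m} \<Longrightarrow> Re (s l) \<le> Re (s m)"
    "\<And>l. l \<in> {1..m} \<Longrightarrow> Im (s l) = yfull m yt l"
proof -
  define P where "P = (\<Sum>k\<le>m. monom (complex_of_real (c k)) k)"
  have coeff: "coeff P k = (if k \<le> m then complex_of_real (c k) else 0)" for k
    by (simp add: P_def coeff_sum)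
  have deg: "degree P = m"
    by (rule antisym) (auto simp: coeff monic intro!: degree_le le_degree)
  have lead: "lead_coeff P = 1" by (simp add: deg coeff monic)
  have "coeff P i \<in> \<real>" for i by (simp add: coeff)
  then obtain xs a where mset: "mset (xs @ [a]) = proots P"
    and admissible: "yfull_admissible (xs @ [a])"
    and dominant: "\<And>x. x \<in># proots P \<Longrightarrow> Re x \<le> Re a"
    using dominant_root_admissible_enumeration[of P] m deg by (metis One_nat_def Suc_le_eq)
  let ?xs = "xs @ [a]"
  have len: "length ?xs = m" using mset deg by (metis size_mset size_proots_complex)
  obtain yt where yt: "\<And>l. l \<in> {1..m} \<Longrightarrow> Im (?xs ! (l - 1)) = yfull m yt l"
    using admissible unfolding yfull_admissible_def len by blast
  show ?thesis
  proof (rule that[of "\<lambda>l. ?xs ! (l - 1)" yt])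
    show "(\<Sum>k\<le>m. complex_of_real (c k) * X ^ k) = (\<Prod>l\<in>{1..m}. X - ?xs ! (l - 1))" for X
      using poly_eq_prod_enumerated_roots[OF lead mset, of X]
      unfolding len by (simp add: P_def poly_sum poly_monom)
    show "Re (?xs ! (l - 1)) \<le> Re (?xs ! (m - 1))" if "l \<in> {1..m}" for l
    proof -
      have "?xs ! (l - 1) \<in> set ?xs" using that len by (intro nth_mem) auto
      then have "?xs ! (l - 1) \<in># proots P" by (simp flip: mset)
      moreover have "?xs ! (m - 1) = a" using len by (auto simp: nth_append)
      ultimately show ?thesis using dominant by simp
    qed
  qed (rule yt)
qed

section \<open>The quadratic module of the program\<close>

lemma yfull_polys:
  assumes "l \<in> {1..m}" "a + nfree m \<le> N"
  shows "(\<lambda>z. yfull m (\<lambda>j. z (a + j)) l) \<in> polys N"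
proof -
  have coordinate: "(\<lambda>z. z (a + j)) \<in> polys N" if "j < nfree m" for j
    using assms(2) that by (intro polys_coordinate) auto
  note intros = coordinate polys.minus polys.diff
  consider (even) "even m" | (one) "m = 1" | (odd) "odd m" "m \<noteq> 1" by blast
  then show ?thesis
  proof cases
    case even
    have "(l + 1) div 2 - 1 < nfree m" "l div 2 - 1 < nfree m"
      using assms by (auto simp: nfree_def)
    then show ?thesis using even by (cases "even l") (simp_all add: yfull_def intros)
  next
    case one
    then show ?thesis using coordinate by (simp add: yfull_def nfree_def)
  next
    case odd
    have "(m - 1) div 2 < nfree m" "l div 2 - 1 < nfree m"
      "(m - 1) div 2 - 1 < nfree m" "(l + 1) div 2 - 1 < nfree m"
      using assms odd by (auto simp: nfree_def)
    then show ?thesis using odd odd_pos[OF odd(1)]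
      by (cases "l = m"; cases "even l"; cases "l = m - 2") (simp_all add: yfull_def intros)
  qed
qed

lemma yfull_cong:
  assumes "l \<in> {1..m}" "\<And>j. j < nfree m \<Longrightarrow> yt j = yt' j"
  shows "yfull m yt l = yfull m yt' l"
  using polys_cong[OF yfull_polys[OF assms(1), of 0 "nfree m"], of yt yt'] assms(2) by simp

lemma free_variable_yfull:
  assumes "j < nfree m"
  obtains l where "l \<in> {1..m}" "\<forall>yt. yfull m yt l = yt j"
proof -
  consider (even) "even m" | (one) "m = 1" | (last) "odd m" "m \<noteq> 1" "j = (m - 1) div 2"
    | (other) "odd m" "m \<noteq> 1" "j \<noteq> (m - 1) div 2" by blast
  then show ?thesis
  proof cases
    case even
    then show ?thesis using assms by (intro that[of "2 * j + 2"]) (auto simp: yfull_def nfree_def)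
  next
    case one
    then show ?thesis using assms by (intro that[of 1]) (auto simp: yfull_def nfree_def)
  next
    case last
    then show ?thesis
      by (intro that[of m]) (auto simp: yfull_def nfree_def Suc_le_eq odd_pos)
  next
    case other
    then have "2 * j + 2 < m" using assms by (auto simp: nfree_def elim!: oddE)
    then show ?thesis using other by (intro that[of "2 * j + 2"]) (auto simp: yfull_def)
  qed
qed

datatype constraint = Unit | Box nat | Dominance nat | Real_part nat | Imag_part nat

lemma ex_constraint_family_iff:
  "(\<exists>\<sigma>. P \<sigma>) \<longleftrightarrow> (\<exists>\<sigma>0 \<sigma> \<sigma>x \<tau>R \<tau>I. P (case_constraint \<sigma>0 \<sigma> \<sigma>x \<tau>R \<tau>I))"
proof
  assume "\<exists>\<sigma>. P \<sigma>"
  then obtain \<sigma> where "P \<sigma>" ..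
  moreover have "\<sigma> = case_constraint (\<sigma> Unit) (\<lambda>j. \<sigma> (Box j)) (\<lambda>k. \<sigma> (Dominance k))
      (\<lambda>k. \<sigma> (Real_part k)) (\<lambda>k. \<sigma> (Imag_part k))"
    by (simp add: fun_eq_iff split: constraint.split)
  ultimately show "\<exists>\<sigma>0 \<sigma> \<sigma>x \<tau>R \<tau>I. P (case_constraint \<sigma>0 \<sigma> \<sigma>x \<tau>R \<tau>I)" by metis
qed blast

locale abscissa_program =
  fixes n m :: nat and p :: "nat \<Rightarrow> (nat \<Rightarrow> real) \<Rightarrow> real"
  assumes m: "m \<ge> 1"
    and nonleading_polys: "k < m \<Longrightarrow> p k \<in> polys n"
    and monic: "p m = (\<lambda>_. 1)"
begin

abbreviation N :: nat where "N \<equiv> n + m + nfree m"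

primrec constraint_fun :: "constraint \<Rightarrow> (nat \<Rightarrow> real) \<Rightarrow> real" where
  "constraint_fun Unit = (\<lambda>_. 1)"
| "constraint_fun (Box j) = (\<lambda>z. 1 - (z (j - 1))\<^sup>2)"
| "constraint_fun (Dominance k) = (\<lambda>z. z (n + m - 1) - z (n + k - 1))"
| "constraint_fun (Real_part k) = (\<lambda>z. (-1) ^ k * p (m - k) z - Rk n m k z)"
| "constraint_fun (Imag_part k) = Ik n m k"

primrec multipliers :: "nat \<Rightarrow> constraint \<Rightarrow> ((nat \<Rightarrow> real) \<Rightarrow> real) set" where
  "multipliers d Unit = Collect (sos N (int d))"
| "multipliers d (Box j) = Collect (sos N (int d - 1))"
| "multipliers d (Dominance k) = Collect (sos N (int d))"
| "multipliers d (Real_part k) = Collect (poly_fun N (2 * int d - int k))"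
| "multipliers d (Imag_part k) = Collect (poly_fun N (2 * int d - int k))"

definition inequalities :: "constraint set" where
  "inequalities = insert Unit (Box ` {1..n} \<union> Dominance ` {1..m - 1})"

definition equations :: "constraint set" where
  "equations = Real_part ` {1..m} \<union> Imag_part ` {1..m}"

abbreviation constraints :: "constraint set" where
  "constraints \<equiv> inequalities \<union> equations"

definition certified :: "nat \<Rightarrow> ((nat \<Rightarrow> real) \<Rightarrow> real) set" where
  "certified d = {(\<lambda>z. \<Sum>c\<in>constraints. \<sigma> c z * constraint_fun c z) | \<sigma>.
     \<forall>c\<in>constraints. \<sigma> c \<in> multipliers d c}"

lemma certifiedI:
  "(\<And>c. c \<in> constraints \<Longrightarrow> \<sigma> c \<in> multipliers d c) \<Longrightarrow>
   (\<And>z. f z = (\<Sum>c\<in>constraints. \<sigma> c z * constraint_fun c z)) \<Longrightarrow> f \<in> certified d"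
  by (auto simp: certified_def fun_eq_iff)

lemma certifiedE:
  assumes "f \<in> certified d"
  obtains \<sigma> where "\<forall>c\<in>constraints. \<sigma> c \<in> multipliers d c"
    "f = (\<lambda>z. \<Sum>c\<in>constraints. \<sigma> c z * constraint_fun c z)"
  using assms by (auto simp: certified_def)

lemma finite_constraints: "finite constraints"
  by (simp add: inequalities_def equations_def)

lemma sum_constraints:
  "sum h constraints = h Unit + (\<Sum>j\<in>{1..n}. h (Box j)) + (\<Sum>k\<in>{1..m-1}. h (Dominance k)) +
     (\<Sum>k\<in>{1..m}. h (Real_part k)) + (\<Sum>k\<in>{1..m}. h (Imag_part k))"
proof -
  have "sum h inequalities = h Unit + (\<Sum>j\<in>{1..n}. h (Box j)) + (\<Sum>k\<in>{1..m-1}. h (Dominance k))"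
    unfolding inequalities_def
    by (subst sum.insert, simp, force, subst sum.union_disjoint)
      (auto simp: sum.reindex inj_on_def add.assoc)
  moreover have "sum h equations = (\<Sum>k\<in>{1..m}. h (Real_part k)) + (\<Sum>k\<in>{1..m}. h (Imag_part k))"
    unfolding equations_def by (subst sum.union_disjoint; auto simp: sum.reindex inj_on_def)
  moreover have "inequalities \<inter> equations = {}"
    by (auto simp: inequalities_def equations_def)
  ultimately show ?thesis
    using finite_constraints by (simp add: sum.union_disjoint add.assoc)
qed

lemma ball_constraints_iff:
  "(\<forall>c\<in>constraints. P c) \<longleftrightarrow> P Unit \<and> (\<forall>j\<in>{1..n}. P (Box j)) \<and> (\<forall>k\<in>{1..m-1}. P (Dominance k)) \<and>
     (\<forall>k\<in>{1..m}. P (Real_part k)) \<and> (\<forall>k\<in>{1..m}. P (Imag_part k))"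
  unfolding inequalities_def equations_def by auto

lemma feasible_iff_certified:
  "feasible n m p d w \<longleftrightarrow> poly_fun n (2 * int d) w \<and> (\<lambda>z. z (n + m - 1) - w z) \<in> certified d"
proof -
  have "(\<lambda>z. z (n + m - 1) - w z) \<in> certified d \<longleftrightarrow>
      (\<exists>\<sigma>. (\<forall>c\<in>constraints. \<sigma> c \<in> multipliers d c) \<and>
        (\<forall>z. z (n + m - 1) - w z = (\<Sum>c\<in>constraints. \<sigma> c z * constraint_fun c z)))"
    by (auto simp: certified_def fun_eq_iff)
  then show ?thesis
    by (simp add: ex_constraint_family_iff feasible_def sum_constraints ball_constraints_iff
        ball_conj_distrib conj_assoc)
qed

lemma multipliers_zero: "(\<lambda>_. 0) \<in> multipliers d c"
  by (cases c) (auto simp: sos_zero poly_fun_zero)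

lemma multipliers_add:
  "f \<in> multipliers d c \<Longrightarrow> g \<in> multipliers d c \<Longrightarrow> (\<lambda>z. f z + g z) \<in> multipliers d c"
  by (cases c) (auto intro: sos_add poly_fun_add)

lemma multipliers_mono: "d \<le> d' \<Longrightarrow> multipliers d c \<subseteq> multipliers d' c"
  by (cases c) (auto elim: sos_mono poly_fun_mono)

lemma multipliers_square_mult:
  assumes f: "f \<in> multipliers d c" and g: "poly_fun N (int e) g"
  shows "(\<lambda>z. (g z)\<^sup>2 * f z) \<in> multipliers (d + e) c"
proof -
  have "sos N (k + int e) (\<lambda>z. (g z)\<^sup>2 * f z)" if "sos N k f" for k
    using sos_square_mult[OF that g] .
  moreover have "poly_fun N (k + 2 * int e) (\<lambda>z. (g z)\<^sup>2 * f z)" if "poly_fun N k f" for k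
    using poly_fun_mult[OF poly_fun_mult[OF g g] that] by (simp add: power2_eq_square algebra_simps)
  ultimately show ?thesis
    using f by (cases c) (fastforce simp: algebra_simps)+
qed

lemma multipliers_subset_polys: "multipliers d c \<subseteq> polys N"
proof -
  have "Collect (poly_fun N k) \<subseteq> polys N" for k by (auto simp: polys_def)
  then show ?thesis by (cases c) (auto intro: sos_imp_polys)
qed

lemma certified_mono: "d \<le> d' \<Longrightarrow> certified d \<subseteq> certified d'"
  using multipliers_mono unfolding certified_def by blast

lemma certified_add:
  assumes "f \<in> certified d" "g \<in> certified d"
  shows "(\<lambda>z. f z + g z) \<in> certified d"
proof -
  obtain \<sigma> \<tau> where "\<forall>c\<in>constraints. \<sigma> c \<in> multipliers d c"
    "\<forall>c\<in>constraints. \<tau> c \<in> multipliers d c"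
    "f = (\<lambda>z. \<Sum>c\<in>constraints. \<sigma> c z * constraint_fun c z)"
    "g = (\<lambda>z. \<Sum>c\<in>constraints. \<tau> c z * constraint_fun c z)"
    using assms by (elim certifiedE)
  then show ?thesis
    by (intro certifiedI[of "\<lambda>c z. \<sigma> c z + \<tau> c z"])
      (simp_all add: multipliers_add distrib_right sum.distrib)
qed

lemma certified_square_mult:
  assumes "f \<in> certified d" and g: "poly_fun N (int e) g"
  shows "(\<lambda>z. (g z)\<^sup>2 * f z) \<in> certified (d + e)"
proof -
  obtain \<sigma> where "\<forall>c\<in>constraints. \<sigma> c \<in> multipliers d c"
    "f = (\<lambda>z. \<Sum>c\<in>constraints. \<sigma> c z * constraint_fun c z)"
    using assms(1) by (elim certifiedE)
  then show ?thesis
    by (intro certifiedI[of "\<lambda>c z. (g z)\<^sup>2 * \<sigma> c z"])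
      (simp_all add: multipliers_square_mult g sum_distrib_left mult.assoc)
qed

lemma multiple_certified:
  assumes c: "c \<in> constraints" and s: "s \<in> multipliers d c"
  shows "(\<lambda>z. s z * constraint_fun c z) \<in> certified d"
proof (rule certifiedI)
  show "(if c' = c then s else (\<lambda>_. 0)) \<in> multipliers d c'" for c'
    using s multipliers_zero by simp
  show "s z * constraint_fun c z =
      (\<Sum>c'\<in>constraints. (if c' = c then s else (\<lambda>_. 0)) z * constraint_fun c' z)" for z
    using c finite_constraints by (simp add: if_distrib[of "\<lambda>f. f z * _"] cong: if_cong)
qed

lemma p_polys: "k \<le> m \<Longrightarrow> p k \<in> polys n"
  using nonleading_polys polys.const by (cases "k = m") (auto simp: monic)

lemma svar_complexification: "l \<in> {1..m} \<Longrightarrow> (\<lambda>z. svar n m z l) \<in> polys.complexification N"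
  by (auto simp: polys.complexification_def svar_def intro!: polys_coordinate yfull_polys)

lemma esym_complexification: "esym n m k \<in> polys.complexification N"
  unfolding esym_def[abs_def]
  by (intro polys.complexification_sum polys.complexification_prod svar_complexification) auto

lemma constraint_fun_polys: "c \<in> constraints \<Longrightarrow> constraint_fun c \<in> polys N"
  using esym_complexification p_polys polys_mono[of n N]
  by (cases c)
    (auto simp: inequalities_def equations_def polys.complexification_def Rk_def Ik_def[abs_def]
      intro!: polys.closed polys_coordinate)

definition M :: "((nat \<Rightarrow> real) \<Rightarrow> real) set" where
  "M = (\<Union>d. certified d)"

sublocale quadratic_module "polys N" M
proof
  show "M \<subseteq> polys N"
    unfolding M_def certified_def
    using multipliers_subset_polys constraint_fun_polys by (fastforce intro!: polys.sum polys.mult)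
  show "(\<lambda>_. 1) \<in> M"
    using multiple_certified[of Unit "\<lambda>_. 1" 0] by (auto simp: M_def inequalities_def sos_one)
next
  fix f g assume "f \<in> M" "g \<in> M"
  then obtain d e where "f \<in> certified d" "g \<in> certified e" by (auto simp: M_def)
  then have "f \<in> certified (max d e)" "g \<in> certified (max d e)"
    using certified_mono[of d "max d e"] certified_mono[of e "max d e"] by auto
  then show "(\<lambda>z. f z + g z) \<in> M" using certified_add by (auto simp: M_def)
next
  fix g f assume "g \<in> polys N" "f \<in> M"
  then obtain e d where "poly_fun N e g" and f: "f \<in> certified d" by (auto simp: M_def polys_def)
  then have "poly_fun N (int (nat e)) g" by (auto elim: poly_fun_mono)
  with f have "(\<lambda>z. (g z)\<^sup>2 * f z) \<in> certified (d + nat e)" by (rule certified_square_mult)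
  then show "(\<lambda>z. (g z)\<^sup>2 * f z) \<in> M" by (auto simp: M_def)
qed

lemma constraint_fun_inequality: "c \<in> inequalities \<Longrightarrow> constraint_fun c \<in> M"
  using multiple_certified[of c "\<lambda>_. 1" 1] by (auto simp: M_def inequalities_def sos_one)

lemma constraint_fun_equation:
  assumes "c \<in> equations"
  shows "constraint_fun c \<in> support"
proof -
  obtain k where "c = Real_part k \<or> c = Imag_part k"
    using assms by (auto simp: equations_def)
  then have "(\<lambda>z. r * constraint_fun c z) \<in> certified k" for r
    using assms by (intro multiple_certified) (auto simp: poly_fun_const)
  then have "(\<lambda>z. r * constraint_fun c z) \<in> M" for r
    by (auto simp: M_def)
  from this[of 1] this[of "-1"] show ?thesis by (simp add: support_def)
qed

definition K :: "(nat \<Rightarrow> real) set" where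
  "K = {z. (\<forall>c\<in>inequalities. constraint_fun c z \<ge> 0) \<and> (\<forall>c\<in>equations. constraint_fun c z = 0)}"

lemma M_nonneg_on_K:
  assumes "f \<in> M" and z: "z \<in> K"
  shows "f z \<ge> 0"
proof -
  obtain d where "f \<in> certified d" using assms(1) by (auto simp: M_def)
  then obtain \<sigma> where \<sigma>: "\<forall>c\<in>constraints. \<sigma> c \<in> multipliers d c"
    and f: "f = (\<lambda>z. \<Sum>c\<in>constraints. \<sigma> c z * constraint_fun c z)"
    by (rule certifiedE)
  have "\<sigma> c z * constraint_fun c z \<ge> 0" if "c \<in> constraints" for c
  proof (cases "c \<in> equations")
    case False
    then have c: "c \<in> inequalities" using that by blast
    then have "\<sigma> c z \<ge> 0"
      using bspec[OF \<sigma> that] by (auto simp: inequalities_def intro: sos_nonneg)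
    then show ?thesis using c z by (simp add: K_def)
  qed (use z in \<open>simp add: K_def\<close>)
  then show ?thesis unfolding f by (rule sum_nonneg)
qed

lemma mem_K_iff_M_nonneg: "z \<in> K \<longleftrightarrow> (\<forall>f\<in>M. f z \<ge> 0)"
proof
  assume nonneg: "\<forall>f\<in>M. f z \<ge> 0"
  have "constraint_fun c z = 0" if "c \<in> equations" for c
  proof -
    have "constraint_fun c \<in> M" "(\<lambda>z. - constraint_fun c z) \<in> M"
      using constraint_fun_equation[OF that] by (simp_all add: support_def)
    from this[THEN bspec[OF nonneg]] have "constraint_fun c z \<ge> 0" "- constraint_fun c z \<ge> 0" .
    then show ?thesis by simp
  qed
  then show "z \<in> K" using nonneg constraint_fun_inequality by (simp add: K_def)
qed (use M_nonneg_on_K in blast)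

definition coeff_defect :: "nat \<Rightarrow> (nat \<Rightarrow> real) \<Rightarrow> complex" where
  "coeff_defect k z = (-1) ^ k * complex_of_real (p (m - k) z) - esym n m k z"

lemma coeff_defect_0: "coeff_defect 0 z = 0"
proof -
  have "{S. S \<subseteq> {1..m} \<and> card S = 0} = {{}}" by (auto simp: finite_subset)
  then show ?thesis by (simp add: coeff_defect_def esym_def monic)
qed

lemma coeff_defect_eq_Complex:
  "coeff_defect k z = Complex (constraint_fun (Real_part k) z) (- constraint_fun (Imag_part k) z)"
proof -
  have "(-1) ^ k * complex_of_real (p (m - k) z) = complex_of_real ((-1) ^ k * p (m - k) z)" by simp
  then show ?thesis
    by (simp add: coeff_defect_def complex_eq_iff Rk_def Ik_def del: of_real_mult)
qed

lemma coeff_defect_complex_support: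
  assumes "k \<le> m"
  shows "coeff_defect k \<in> complex_support"
proof (cases "k = 0")
  case True
  then show ?thesis
    using coeff_defect_0 by (simp add: complex_support_def support_def qm_const)
next
  case False
  then have "Real_part k \<in> equations" "Imag_part k \<in> equations"
    using assms by (auto simp: equations_def)
  then show ?thesis
    unfolding complex_support_def coeff_defect_eq_Complex
    by (auto intro: constraint_fun_equation support_minus simp del: constraint_fun.simps)
qed

lemma characteristic_polynomial_eq:
  "(\<Sum>k\<le>m. complex_of_real (p k z) * X ^ k) = (\<Prod>l\<in>{1..m}. X - svar n m z l) +
     (\<Sum>k\<le>m. (-1) ^ k * coeff_defect k z * X ^ (m - k))"
proof -
  have "(\<Sum>k\<le>m. complex_of_real (p k z) * X ^ k) =
      (\<Sum>k\<le>m. complex_of_real (p (m - k) z) * X ^ (m - k))"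
    by (rule sum.reindex_bij_witness[of _ "\<lambda>k. m - k" "\<lambda>k. m - k"]) auto
  also have "\<dots> = (\<Sum>k\<le>m. (-1) ^ k * esym n m k z * X ^ (m - k)) +
      (\<Sum>k\<le>m. (-1) ^ k * coeff_defect k z * X ^ (m - k))"
    unfolding coeff_defect_def
    by (simp add: algebra_simps flip: sum.distrib power_add mult_2 add: power_mult)
  also have "(\<Sum>k\<le>m. (-1) ^ k * esym n m k z * X ^ (m - k)) = (\<Prod>l\<in>{1..m}. X - svar n m z l)"
    using vieta[of "{1..m}" X "svar n m z"] by (simp add: esym_def)
  finally show ?thesis .
qed

lemma coeff_defects_zero_iff:
  "(\<forall>k\<le>m. coeff_defect k z = 0) \<longleftrightarrow>
   (\<forall>X. (\<Sum>k\<le>m. complex_of_real (p k z) * X ^ k) = (\<Prod>l\<in>{1..m}. X - svar n m z l))"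
proof -
  let ?a = "\<lambda>i. (-1) ^ (m - i) * coeff_defect (m - i) z"
  have "(\<Sum>k\<le>m. (-1) ^ k * coeff_defect k z * X ^ (m - k)) = (\<Sum>i\<le>m. ?a i * X ^ i)" for X
    by (rule sum.reindex_bij_witness[of _ "\<lambda>i. m - i" "\<lambda>k. m - k"]) auto
  then have "(\<forall>X. (\<Sum>k\<le>m. complex_of_real (p k z) * X ^ k) = (\<Prod>l\<in>{1..m}. X - svar n m z l)) \<longleftrightarrow>
      (\<forall>X. (\<Sum>i\<le>m. ?a i * X ^ i) = 0)"
    by (simp add: characteristic_polynomial_eq)
  also have "\<dots> \<longleftrightarrow> (\<forall>i\<le>m. ?a i = 0)"
    by (rule polyfun_eq_0)
  also have "\<dots> \<longleftrightarrow> (\<forall>k\<le>m. coeff_defect k z = 0)"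
    by simp (metis diff_diff_cancel diff_le_self)
  finally show ?thesis by blast
qed

lemma mem_K_iff:
  "z \<in> K \<longleftrightarrow> (\<forall>j<n. (z j)\<^sup>2 \<le> 1) \<and> (\<forall>l\<in>{1..m}. z (n + l - 1) \<le> z (n + m - 1)) \<and>
     (\<forall>X. (\<Sum>k\<le>m. complex_of_real (p k z) * X ^ k) = (\<Prod>l\<in>{1..m}. X - svar n m z l))"
proof -
  have "(\<forall>j\<in>{1..n}. (z (j - 1))\<^sup>2 \<le> 1) \<longleftrightarrow> (\<forall>j<n. (z j)\<^sup>2 \<le> 1)"
    unfolding image_Suc_lessThan[symmetric] by auto
  moreover have "(\<forall>k\<in>{1..m-1}. z (n + k - 1) \<le> z (n + m - 1)) \<longleftrightarrow>
      (\<forall>l\<in>{1..m}. z (n + l - 1) \<le> z (n + m - 1))"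
  proof -
    have "{1..m} = insert m {1..m-1}" using m by auto
    then show ?thesis by simp
  qed
  moreover have "(\<forall>c\<in>equations. constraint_fun c z = 0) \<longleftrightarrow> (\<forall>k\<in>{1..m}. coeff_defect k z = 0)"
    by (simp add: equations_def coeff_defect_eq_Complex Complex_eq_0 ball_Un ball_conj_distrib)
  moreover have "\<dots> \<longleftrightarrow> (\<forall>k\<le>m. coeff_defect k z = 0)"
    using coeff_defect_0 by (auto simp: Suc_le_eq)
  ultimately show ?thesis
    unfolding K_def coeff_defects_zero_iff[symmetric] by (simp add: inequalities_def ball_Un)
qed

lemma abscissa_on_K:
  assumes z: "z \<in> K"
  shows "abscissa m p z = z (n + m - 1)"
proof -
  have "{Re s |s. (\<Sum>k\<le>m. complex_of_real (p k z) * s ^ k) = 0} = Re ` svar n m z ` {1..m}"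
    using z by (auto simp: mem_K_iff)
  also have "\<dots> = (\<lambda>l. z (n + l - 1)) ` {1..m}" by (simp add: image_image svar_def)
  finally have "abscissa m p z = Max ((\<lambda>l. z (n + l - 1)) ` {1..m})" by (simp add: abscissa_def)
  also have "\<dots> = z (n + m - 1)"
    using z m by (intro Max_eqI) (auto simp: mem_K_iff)
  finally show ?thesis .
qed

lemma p_cong: "k \<le> m \<Longrightarrow> (\<And>i. i < n \<Longrightarrow> q i = q' i) \<Longrightarrow> p k q = p k q'"
  using polys_cong[OF p_polys] .

lemma abscissa_restrict:
  assumes "z \<in> K"
  shows "abscissa m p (restrict z {..<n}) = z (n + m - 1)"
proof -
  have "p k (restrict z {..<n}) = p k z" if "k \<le> m" for k
    using that by (rule p_cong) simp
  then have "abscissa m p (restrict z {..<n}) = abscissa m p z"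
    by (simp add: abscissa_def)
  then show ?thesis using abscissa_on_K[OF assms] by simp
qed

lemma restrict_K_in_Qbox: "z \<in> K \<Longrightarrow> restrict z {..<n} \<in> Qbox n"
  by (auto simp: mem_K_iff Qbox_def abs_square_le_1 abs_le_iff)

lemma Qbox_lift:
  assumes q: "q \<in> Qbox n"
  obtains z where "z \<in> K" "z \<in> extensional {..<N}" "restrict z {..<n} = q"
proof -
  obtain s yt where s: "\<And>X. (\<Sum>k\<le>m. complex_of_real (p k q) * X ^ k) = (\<Prod>l\<in>{1..m}. X - s l)"
    and dominant: "\<And>l. l \<in> {1..m} \<Longrightarrow> Re (s l) \<le> Re (s m)"
    and Im: "\<And>l. l \<in> {1..m} \<Longrightarrow> Im (s l) = yfull m yt l"
    using root_arrangement[of m "\<lambda>k. p k q"] m by (auto simp: monic)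
  define z where "z = (\<lambda>i\<in>{..<N}. if i < n then q i else if i < n + m then Re (s (i - n + 1))
    else yt (i - (n + m)))"
  have z_q: "z i = q i" if "i < n" for i using that by (simp add: z_def)
  have z_s: "svar n m z l = s l" if l: "l \<in> {1..m}" for l
  proof -
    have "yfull m (\<lambda>j. z (n + m + j)) l = yfull m yt l"
      using l by (rule yfull_cong) (simp add: z_def)
    moreover have "z (n + l - 1) = Re (s l)" using l by (auto simp: z_def)
    ultimately show ?thesis using Im[OF l] by (simp add: svar_def complex_eq_iff)
  qed
  have "z \<in> K"
    unfolding mem_K_iff
  proof (intro conjI allI ballI impI)
    show "(z j)\<^sup>2 \<le> 1" if "j < n" for j
      using q that by (auto simp: z_q Qbox_def PiE_iff abs_square_le_1 abs_le_iff)
    show "z (n + l - 1) \<le> z (n + m - 1)" if "l \<in> {1..m}" for l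
      using dominant[OF that] z_s[OF that] z_s[of m] m by (auto simp: svar_def complex_eq_iff)
    show "(\<Sum>k\<le>m. complex_of_real (p k z) * X ^ k) = (\<Prod>l\<in>{1..m}. X - svar n m z l)" for X
      using s[of X] p_cong[of _ z q] by (simp add: z_s z_q)
  qed
  moreover have "z \<in> extensional {..<N}" by (simp add: z_def)
  moreover have "restrict z {..<n} = q"
    using q by (auto simp: z_q Qbox_def PiE_iff extensional_def fun_eq_iff)
  ultimately show ?thesis by (rule that)
qed

notation qm_le (infix "\<preceq>" 50)

lemma qm_le_on_K: "f \<preceq> g \<Longrightarrow> z \<in> K \<Longrightarrow> f z \<le> g z"
  using M_nonneg_on_K unfolding qm_le_def by fastforce

lemma qm_bounded_parameter:
  assumes "j < n"
  shows "qm_bounded (\<lambda>z. z j)"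
proof (rule qm_bounded_if_square_qm_le)
  show "(\<lambda>z. z j) \<in> polys N" using assms by (intro polys_coordinate) simp
  show "(\<lambda>z. (z j)\<^sup>2) \<preceq> (\<lambda>_. 1)"
    using constraint_fun_inequality[of "Box (Suc j)"] assms
    by (auto simp: qm_le_def inequalities_def)
qed

lemma qm_bounded_parameter_poly: "f \<in> polys n \<Longrightarrow> qm_bounded f"
  by (induction rule: polys_induct)
    (auto intro: qm_bounded_const qm_bounded_add qm_bounded_mult qm_bounded_parameter)

lemma svar_bounded:
  assumes l: "l \<in> {1..m}"
  shows "\<exists>c. (\<lambda>z. (cmod (svar n m z l))\<^sup>2) \<preceq> (\<lambda>_. c)"
proof (rule cmod_square_bounded_if_monic_root)
  let ?s = "\<lambda>z. svar n m z l"
  show s: "?s \<in> polys.complexification N" using l by (rule svar_complexification)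
  show "(\<lambda>z. complex_of_real (p k z)) \<in> polys.complexification N" if "k < m" for k
    using that p_polys[of k] polys_mono[of n N] by (intro polys.complexification_of_real) auto
  show "\<exists>c. (\<lambda>z. (cmod (complex_of_real (p k z)))\<^sup>2) \<preceq> (\<lambda>_. c)" if "k < m" for k
    using qm_bounded_square[OF qm_bounded_parameter_poly[OF p_polys[of k]]] that
    by (auto simp: qm_bounded_def)
  show "m > 0" using m by simp
  have root: "(\<Prod>j\<in>{1..m}. ?s z - svar n m z j) = 0" for z using l by auto
  have "(\<Sum>k\<le>m. complex_of_real (p k z) * ?s z ^ k) =
      ?s z ^ m + (\<Sum>k<m. complex_of_real (p k z) * ?s z ^ k)" for z
    by (simp add: monic flip: lessThan_Suc_atMost)
  moreover have "(\<Sum>k\<le>m. complex_of_real (p k z) * ?s z ^ k) =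
      (\<Sum>k\<le>m. ((-1) ^ k * ?s z ^ (m - k)) * coeff_defect k z)" for z
    unfolding characteristic_polynomial_eq root by (simp add: mult_ac)
  moreover have "(\<lambda>z. \<Sum>k\<le>m. ((-1) ^ k * ?s z ^ (m - k)) * coeff_defect k z) \<in> complex_support"
    by (intro complex_support_sum complex_support_mult coeff_defect_complex_support
        polys.complexification_closed s) auto
  ultimately show "(\<lambda>z. ?s z ^ m + (\<Sum>k<m. complex_of_real (p k z) * ?s z ^ k)) \<in> complex_support"
    by simp
qed

lemma qm_bounded_svar_parts:
  assumes l: "l \<in> {1..m}"
  shows "qm_bounded (\<lambda>z. Re (svar n m z l))" "qm_bounded (\<lambda>z. Im (svar n m z l))"
proof -
  obtain c where c: "(\<lambda>z. (cmod (svar n m z l))\<^sup>2) \<preceq> (\<lambda>_. c)" using svar_bounded[OF l] by blast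
  have parts: "(\<lambda>z. Re (svar n m z l)) \<in> polys N" "(\<lambda>z. Im (svar n m z l)) \<in> polys N"
    using svar_complexification[OF l] by (auto simp: polys.complexification_def)
  have "(\<lambda>z. (Re (svar n m z l))\<^sup>2) \<preceq> (\<lambda>z. (cmod (svar n m z l))\<^sup>2)"
    "(\<lambda>z. (Im (svar n m z l))\<^sup>2) \<preceq> (\<lambda>z. (cmod (svar n m z l))\<^sup>2)"
    using qm_square[OF parts(1)] qm_square[OF parts(2)] by (simp_all add: qm_le_def cmod_power2)
  then show "qm_bounded (\<lambda>z. Re (svar n m z l))" "qm_bounded (\<lambda>z. Im (svar n m z l))"
    using parts qm_le_trans[OF _ c] by (auto intro: qm_bounded_if_square_qm_le)
qed

lemma qm_bounded_coordinate:
  assumes "i < N"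
  shows "qm_bounded (\<lambda>z. z i)"
proof -
  consider (parameter) "i < n" | (real) "n \<le> i" "i < n + m" | (imaginary) "n + m \<le> i" by linarith
  then show ?thesis
  proof cases
    case parameter
    then show ?thesis by (rule qm_bounded_parameter)
  next
    case real
    then show ?thesis using qm_bounded_svar_parts(1)[of "i - n + 1"] by (auto simp: svar_def)
  next
    case imaginary
    then have "i - (n + m) < nfree m" using assms by simp
    then obtain l where "l \<in> {1..m}" "\<forall>yt. yfull m yt l = yt (i - (n + m))"
      by (rule free_variable_yfull)
    then show ?thesis using qm_bounded_svar_parts(2)[of l] imaginary by (simp add: svar_def)
  qed
qed

sublocale archimedean_module "polys N" M
proof
  show "\<exists>c. f \<preceq> (\<lambda>_. c)" if "f \<in> polys N" for f
  proof -
    have "qm_bounded f"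
      using that by (induction rule: polys_induct)
        (auto intro: qm_bounded_const qm_bounded_add qm_bounded_mult qm_bounded_coordinate)
    then show ?thesis by (auto simp: qm_bounded_def)
  qed
qed

lemma positive_on_K_imp_mem_M:
  assumes "f \<in> polys N" "\<And>z. z \<in> K \<Longrightarrow> f z > 0"
  shows "f \<in> M"
  using archimedean_module_axioms assms(1)
  by (rule putinar) (auto intro: assms(2) simp: mem_K_iff_M_nonneg)

end

section \<open>Continuity and integrals on the box\<close>

lemma compact_PiE:
  fixes S :: "'i \<Rightarrow> 'b::topological_space set"
  assumes "\<And>i. i \<in> I \<Longrightarrow> compact (S i)"
  shows "compact (PiE I S)"
proof -
  let ?S = "\<lambda>i. if i \<in> I then S i else {undefined}"
  have "PiE I S = PiE UNIV ?S"
    by (fastforce simp: PiE_iff extensional_def split: if_splits)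
  moreover have "compactin (product_topology (\<lambda>_. euclidean) UNIV) (PiE UNIV ?S)"
    using assms by (simp add: compactin_PiE compactin_euclidean_iff)
  ultimately show ?thesis
    by (simp add: euclidean_product_topology compactin_euclidean_iff)
qed

lemma continuous_on_image_factor:
  fixes \<pi> :: "'a::topological_space \<Rightarrow> 'b::t2_space" and f :: "'b \<Rightarrow> 'c::topological_space"
  assumes C: "compact C" and \<pi>: "continuous_on C \<pi>" and f\<pi>: "continuous_on C (\<lambda>z. f (\<pi> z))"
  shows "continuous_on (\<pi> ` C) f"
  unfolding continuous_on_closed_invariant
proof (intro allI impI)
  fix B :: "'c set" assume "closed B"
  then obtain T where T: "closed T" "T \<inter> C = (\<lambda>z. f (\<pi> z)) -` B \<inter> C"
    using f\<pi> unfolding continuous_on_closed_invariant by blast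
  have "compact (C \<inter> T)" using C T(1) by (rule compact_Int_closed)
  then have "closed (\<pi> ` (C \<inter> T))"
    using \<pi>
    by (intro compact_imp_closed compact_continuous_image) (auto intro: continuous_on_subset)
  moreover have "\<pi> ` (C \<inter> T) \<inter> \<pi> ` C = f -` B \<inter> \<pi> ` C" using T(2) by blast
  ultimately show "\<exists>A. closed A \<and> A \<inter> \<pi> ` C = f -` B \<inter> \<pi> ` C" by blast
qed

lemma compact_Qbox: "compact (Qbox n)"
  unfolding Qbox_def by (rule compact_PiE) simp

lemma sets_Qbox: "Qbox n \<in> sets (Leb n)"
  unfolding Qbox_def Leb_def by (intro sets_PiM_I_finite) auto

lemma emeasure_Qbox_finite: "emeasure (Leb n) (Qbox n) < \<infinity>"
proof -
  interpret product_sigma_finite "\<lambda>_::nat. lborel :: real measure" ..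
  have "emeasure (Leb n) (Qbox n) = (\<Prod>i<n. emeasure lborel {-1..1::real})"
    unfolding Leb_def Qbox_def by (rule emeasure_PiM) auto
  also have "\<dots> \<noteq> top" by (simp add: ennreal_prod_eq_top del: prod_constant)
  finally show ?thesis by (simp add: less_top)
qed

lemma measurable_ident_Leb: "(\<lambda>q. q) \<in> borel_measurable (Leb n)"
proof (rule measurable_coordinatewise_then_product)
  fix i
  show "(\<lambda>q. q i) \<in> borel_measurable (Leb n)"
  proof (cases "i < n")
    case True
    then show ?thesis
      using measurable_component_singleton[of i "{..<n}" "\<lambda>_. lborel :: real measure"]
      by (simp add: Leb_def)
  next
    case False
    then have "q i = undefined" if "q \<in> space (Leb n)" for q
      using that by (auto simp: Leb_def space_PiM PiE_iff extensional_def)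
    then show ?thesis by (subst measurable_cong[where g = "\<lambda>_. undefined"]) auto
  qed
qed

lemma continuous_on_Qbox_integrable:
  fixes f :: "(nat \<Rightarrow> real) \<Rightarrow> real"
  assumes f: "continuous_on (Qbox n) f"
  shows "set_integrable (Leb n) (Qbox n) f"
proof -
  have "(\<lambda>q. indicator (Qbox n) q *\<^sub>R f q) \<in> borel_measurable borel"
    using compact_Qbox f by (intro borel_measurable_continuous_on_indicator borel_compact)
  then have measurable: "(\<lambda>q. indicator (Qbox n) q *\<^sub>R f q) \<in> borel_measurable (Leb n)"
    by (rule measurable_compose[OF measurable_ident_Leb])
  obtain B where "\<And>q. q \<in> Qbox n \<Longrightarrow> norm (f q) \<le> B"
    using compact_imp_bounded[OF compact_continuous_image[OF f compact_Qbox]]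
    by (auto simp: bounded_iff)
  then have "AE q in Leb n. q \<in> Qbox n \<longrightarrow> norm (indicator (Qbox n) q *\<^sub>R f q) \<le> B" by simp
  from integrableI_bounded_set_indicator[OF sets_Qbox measurable emeasure_Qbox_finite this]
  have "integrable (Leb n) (\<lambda>q. indicator (Qbox n) q *\<^sub>R (indicator (Qbox n) q *\<^sub>R f q))" .
  moreover have "indicator (Qbox n) q *\<^sub>R (indicator (Qbox n) q *\<^sub>R f q) =
      indicator (Qbox n) q *\<^sub>R f q" for q
    by (simp add: indicator_def)
  ultimately show ?thesis unfolding set_integrable_def by (simp only:)
qed

lemma polys_dense_on_Qbox:
  assumes "continuous_on (Qbox n) f" "e > 0"
  obtains g where "g \<in> polys n" "\<And>q. q \<in> Qbox n \<Longrightarrow> \<bar>f q - g q\<bar> < e"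
proof -
  interpret function_ring_on "polys n" "Qbox n"
  proof
    fix x y :: "nat \<Rightarrow> real" assume xy: "x \<in> Qbox n" "y \<in> Qbox n" "x \<noteq> y"
    then obtain i where i: "x i \<noteq> y i" by auto
    then have "i < n" using xy by (auto simp: Qbox_def PiE_iff extensional_def)
    then show "\<exists>f\<in>polys n. f x \<noteq> f y" using i by (intro bexI[of _ "\<lambda>z. z i"] polys_coordinate)
  qed (auto intro: compact_Qbox continuous_on_polys polys.closed)
  show ?thesis using Stone_Weierstrass_basic[OF assms] that by blast
qed

section \<open>Convergence\<close>

context abscissa_program
begin

abbreviation box_integral :: "((nat \<Rightarrow> real) \<Rightarrow> real) \<Rightarrow> real" where
  "box_integral f \<equiv> LINT q:Qbox n|Leb n. f q"

lemma compact_K_extensional: "compact (K \<inter> extensional {..<N})"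
proof -
  have "\<exists>c. (\<lambda>_. - c) \<preceq> (\<lambda>z. z i) \<and> (\<lambda>z. z i) \<preceq> (\<lambda>_. c)" if "i < N" for i
    using qm_bounded_coordinate[OF that] by (simp add: qm_bounded_def)
  then obtain c where c: "\<And>i. i < N \<Longrightarrow> (\<lambda>_. - c i) \<preceq> (\<lambda>z. z i)" "\<And>i. i < N \<Longrightarrow> (\<lambda>z. z i) \<preceq> (\<lambda>_. c i)"
    by metis
  have "z i \<in> {- c i..c i}" if "z \<in> K" "i < N" for z i
    using c[OF that(2), THEN qm_le_on_K, OF that(1)] by simp
  then have "K \<inter> extensional {..<N} = PiE {..<N} (\<lambda>i. {- c i..c i}) \<inter> K"
    by (simp only: set_eq_iff Int_iff PiE_iff lessThan_iff) blast
  moreover have "closed K"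
  proof -
    have "K = (\<Inter>f\<in>M. {z. 0 \<le> f z})" using mem_K_iff_M_nonneg by blast
    moreover have "closed {z. 0 \<le> f z}" if "f \<in> M" for f
      using that qm_subset
      by (intro closed_Collect_le continuous_on_polys[of _ N] continuous_on_const) auto
    ultimately show ?thesis by auto
  qed
  ultimately show ?thesis by (auto intro: compact_Int_closed compact_PiE)
qed

lemma continuous_on_abscissa: "continuous_on (Qbox n) (abscissa m p)"
proof -
  let ?C = "K \<inter> extensional {..<N}" and ?\<pi> = "\<lambda>z. restrict z {..<n}"
  have "continuous_on ?C ?\<pi>"
  proof (rule continuous_on_coordinatewise_then_product)
    show "continuous_on ?C (\<lambda>z. ?\<pi> z i)" for i
      by (cases "i < n") (auto intro: continuous_on_subset[OF continuous_on_product_coordinates])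
  qed
  moreover have "continuous_on ?C (\<lambda>z. abscissa m p (?\<pi> z))"
    using abscissa_restrict
    by (subst continuous_on_cong[OF refl, of _ _ "\<lambda>z. z (n + m - 1)"])
      (auto intro: continuous_on_subset[OF continuous_on_product_coordinates])
  ultimately have "continuous_on (?\<pi> ` ?C) (abscissa m p)"
    by (rule continuous_on_image_factor[where f = "abscissa m p", OF compact_K_extensional])
  moreover have "Qbox n \<subseteq> ?\<pi> ` ?C"
  proof
    fix q assume "q \<in> Qbox n"
    then obtain z where "z \<in> K" "z \<in> extensional {..<N}" "?\<pi> z = q" by (rule Qbox_lift)
    then show "q \<in> ?\<pi> ` ?C" by blast
  qed
  ultimately show ?thesis by (rule continuous_on_subset)
qed

lemma abscissa_integrable: "set_integrable (Leb n) (Qbox n) (abscissa m p)"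
  by (rule continuous_on_Qbox_integrable[OF continuous_on_abscissa])

lemma feasible_imp_polys: "feasible n m p d w \<Longrightarrow> w \<in> polys n"
  by (auto simp: feasible_def polys_def)

lemma feasible_integrable: "feasible n m p d w \<Longrightarrow> set_integrable (Leb n) (Qbox n) w"
  by (intro continuous_on_Qbox_integrable continuous_on_polys[of _ n] feasible_imp_polys)

lemma feasible_le_abscissa:
  assumes w: "feasible n m p d w" and "q \<in> Qbox n"
  shows "w q \<le> abscissa m p q"
proof -
  obtain z where z: "z \<in> K" and q: "restrict z {..<n} = q"
    using Qbox_lift[OF assms(2)] by blast
  have "(\<lambda>z. z (n + m - 1) - w z) \<in> M"
    using w by (auto simp: feasible_iff_certified M_def)
  from M_nonneg_on_K[OF this z] have "w z \<le> z (n + m - 1)" by simp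
  moreover have "w z = w q"
    using feasible_imp_polys[OF w] by (rule polys_cong) (simp flip: q)
  ultimately show ?thesis using abscissa_restrict[OF z] q by simp
qed

lemma less_abscissa_imp_eventually_feasible:
  assumes w: "w \<in> polys n" and less: "\<And>q. q \<in> Qbox n \<Longrightarrow> w q < abscissa m p q"
  shows "\<forall>\<^sub>F d in sequentially. feasible n m p d w"
proof -
  obtain k where k: "poly_fun n k w" using w by (auto simp: polys_def)
  have "(\<lambda>z. z (n + m - 1) - w z) \<in> M"
  proof (rule positive_on_K_imp_mem_M)
    show "(\<lambda>z. z (n + m - 1) - w z) \<in> polys N"
      using w polys_mono[of n N] m by (intro polys.closed polys_coordinate) auto
    fix z assume z: "z \<in> K"
    have "w z = w (restrict z {..<n})" using w by (rule polys_cong) simp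
    also have "\<dots> < abscissa m p (restrict z {..<n})" by (rule less[OF restrict_K_in_Qbox[OF z]])
    also have "\<dots> = z (n + m - 1)" by (rule abscissa_restrict[OF z])
    finally show "z (n + m - 1) - w z > 0" by simp
  qed
  then obtain d' where d': "(\<lambda>z. z (n + m - 1) - w z) \<in> certified d'" by (auto simp: M_def)
  show ?thesis
    using eventually_ge_at_top[of "max d' (nat k)"]
  proof eventually_elim
    case (elim d)
    then have "poly_fun n (2 * int d) w" by (intro poly_fun_mono[OF k]) auto
    then show ?case using certified_mono[of d' d] d' elim by (auto simp: feasible_iff_certified)
  qed
qed

lemma feasible_integral_le:
  assumes "feasible n m p d w"
  shows "box_integral w \<le> box_integral (abscissa m p)"
  using assms
  by (intro set_integral_mono feasible_integrable abscissa_integrable feasible_le_abscissa)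

lemma rho_le:
  assumes "feasible n m p d w"
  shows "rho n m p d \<le> box_integral (abscissa m p)"
  unfolding rho_def using assms by (intro cSup_least) (auto intro: feasible_integral_le)

lemma feasible_integral_le_rho:
  assumes "feasible n m p d w"
  shows "box_integral w \<le> rho n m p d"
  unfolding rho_def
  using assms feasible_integral_le by (intro cSup_upper bdd_aboveI) auto

lemma eventually_feasible_near_optimal:
  assumes e: "e > 0"
  obtains w where "\<forall>\<^sub>F d in sequentially. feasible n m p d w"
    "box_integral (abscissa m p) - e \<le> box_integral w"
proof -
  define V where "V = measure (Leb n) (Qbox n)"
  define \<delta> where "\<delta> = e / (2 * (V + 1))"
  have V: "V \<ge> 0" by (simp add: V_def)
  then have \<delta>: "\<delta> > 0" "2 * \<delta> * V \<le> e" using e by (simp_all add: \<delta>_def field_simps)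
  have "continuous_on (Qbox n) (\<lambda>q. abscissa m p q - \<delta>)"
    by (intro continuous_intros continuous_on_abscissa)
  from polys_dense_on_Qbox[OF this \<delta>(1)] obtain w
    where w: "w \<in> polys n" and near: "\<And>q. q \<in> Qbox n \<Longrightarrow> \<bar>abscissa m p q - \<delta> - w q\<bar> < \<delta>" by blast
  have "w q < abscissa m p q" if "q \<in> Qbox n" for q
    using near[OF that] by linarith
  with w have feasible: "\<forall>\<^sub>F d in sequentially. feasible n m p d w"
    by (rule less_abscissa_imp_eventually_feasible)
  have const_integrable: "set_integrable (Leb n) (Qbox n) (\<lambda>_. 2 * \<delta>)"
    by (intro continuous_on_Qbox_integrable continuous_on_const)
  have "box_integral (abscissa m p) - 2 * \<delta> * V =
      box_integral (\<lambda>q. abscissa m p q - 2 * \<delta>)"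
    using set_integral_diff(2)[OF abscissa_integrable const_integrable] sets_Qbox emeasure_Qbox_finite[of n]
    by (simp add: V_def set_lebesgue_integral_def mult.commute)
  also have "\<dots> \<le> box_integral w"
  proof (rule set_integral_mono)
    show "set_integrable (Leb n) (Qbox n) (\<lambda>q. abscissa m p q - 2 * \<delta>)"
      using abscissa_integrable const_integrable by (rule set_integral_diff)
    show "set_integrable (Leb n) (Qbox n) w"
      using w by (intro continuous_on_Qbox_integrable continuous_on_polys)
    show "abscissa m p q - 2 * \<delta> \<le> w q" if "q \<in> Qbox n" for q
      using near[OF that] by linarith
  qed
  finally show ?thesis using that[OF feasible] \<delta>(2) by simp
qed

theorem rho_tendsto: "rho n m p \<longlonglongrightarrow> box_integral (abscissa m p)"
proof (rule tendstoI)
  fix e :: real assume "e > 0"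
  then obtain w where feasible: "\<forall>\<^sub>F d in sequentially. feasible n m p d w"
    and near: "box_integral (abscissa m p) - e / 2 \<le> box_integral w"
    using eventually_feasible_near_optimal[of "e / 2"] by auto
  from feasible
  show "\<forall>\<^sub>F d in sequentially. dist (rho n m p d) (box_integral (abscissa m p)) < e"
  proof eventually_elim
    case (elim d)
    then show ?case
      using rho_le[OF elim] feasible_integral_le_rho[OF elim] near \<open>e > 0\<close>
      by (simp add: dist_real_def)
  qed
qed

lemma L1_distance_feasible:
  assumes w: "feasible n m p d w"
  shows "(\<integral>\<^sup>+ q\<in>Qbox n. ennreal \<bar>w q - abscissa m p q\<bar> \<partial>Leb n) =
    ennreal (box_integral (abscissa m p) - box_integral w)"
proof -
  let ?gap = "\<lambda>q. indicator (Qbox n) q *\<^sub>R (abscissa m p q - w q)"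
  have w_le: "w q \<le> abscissa m p q" if "q \<in> Qbox n" for q by (rule feasible_le_abscissa[OF w that])
  have "(\<integral>\<^sup>+ q\<in>Qbox n. ennreal \<bar>w q - abscissa m p q\<bar> \<partial>Leb n) = (\<integral>\<^sup>+ q. ennreal (?gap q) \<partial>Leb n)"
    using w_le by (intro nn_integral_cong) (auto simp: indicator_def)
  also have "\<dots> = ennreal (\<integral>q. ?gap q \<partial>Leb n)"
    using set_integral_diff(1)[OF abscissa_integrable feasible_integrable[OF w]] w_le
    by (intro nn_integral_eq_integral) (auto simp: set_integrable_def indicator_def)
  also have "(\<integral>q. ?gap q \<partial>Leb n) = box_integral (abscissa m p) - box_integral w"
    using set_integral_diff(2)[OF abscissa_integrable feasible_integrable[OF w]]
    by (simp add: set_lebesgue_integral_def)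
  finally show ?thesis .
qed

lemma near_optimal_integral_tendsto:
  assumes "\<forall>\<^sub>F d in sequentially. feasible n m p d (w d)"
    and near: "\<forall>\<^sub>F d in sequentially. rho n m p d - \<epsilon> d \<le> box_integral (w d)"
    and "\<epsilon> \<longlonglongrightarrow> 0"
  shows "(\<lambda>d. box_integral (w d)) \<longlonglongrightarrow> box_integral (abscissa m p)"
proof (rule tendsto_sandwich[OF near _ _ rho_tendsto])
  show "\<forall>\<^sub>F d in sequentially. box_integral (w d) \<le> rho n m p d"
    using assms(1) by (rule eventually_mono) (rule feasible_integral_le_rho)
  show "(\<lambda>d. rho n m p d - \<epsilon> d) \<longlonglongrightarrow> box_integral (abscissa m p)"
    using tendsto_diff[OF rho_tendsto assms(3)] by simp
qed

lemma L1_tendsto_zero: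
  assumes feasible: "\<forall>\<^sub>F d in sequentially. feasible n m p d (w d)"
    and "(\<lambda>d. box_integral (w d)) \<longlonglongrightarrow> box_integral (abscissa m p)"
  shows "(\<lambda>d. \<integral>\<^sup>+ q\<in>Qbox n. ennreal \<bar>w d q - abscissa m p q\<bar> \<partial>Leb n) \<longlonglongrightarrow> 0"
proof (rule Lim_transform_eventually)
  show "(\<lambda>d. ennreal (box_integral (abscissa m p) - box_integral (w d))) \<longlonglongrightarrow> 0"
    using tendsto_diff[OF tendsto_const[of "box_integral (abscissa m p)"] assms(2)]
    by (auto dest: tendsto_ennrealI)
  show "\<forall>\<^sub>F d in sequentially. ennreal (box_integral (abscissa m p) - box_integral (w d)) =
      (\<integral>\<^sup>+ q\<in>Qbox n. ennreal \<bar>w d q - abscissa m p q\<bar> \<partial>Leb n)"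
    using feasible by (rule eventually_mono) (simp add: L1_distance_feasible)
qed

end

theorem theorem2:
  fixes n m d0 :: nat
    and p :: "nat \<Rightarrow> (nat \<Rightarrow> real) \<Rightarrow> real"
    and w :: "nat \<Rightarrow> (nat \<Rightarrow> real) \<Rightarrow> real"
  assumes "n \<ge> 1" and "m \<ge> 1"
    and "\<forall>k<m. \<exists>e. poly_fun n e (p k)"
    and "p m = (\<lambda>_. 1)"
    and "\<forall>d\<ge>d0. \<exists>v. feasible n m p d v"
    and "\<forall>d\<ge>d0. feasible n m p d (w d) \<and>
                 (LINT q:Qbox n|Leb n. w d q) \<ge> rho n m p d - 1 / real d"
  shows "(\<forall>d\<ge>d0. \<forall>q\<in>Qbox n. w d q \<le> abscissa m p q) \<and>
         ((\<lambda>d. \<integral>\<^sup>+ q\<in>Qbox n. ennreal \<bar>w d q - abscissa m p q\<bar> \<partial>Leb n) \<longlonglongrightarrow> 0)"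
proof
  interpret abscissa_program n m p
    using assms by unfold_locales (auto simp: polys_def)
  show "\<forall>d\<ge>d0. \<forall>q\<in>Qbox n. w d q \<le> abscissa m p q"
    using feasible_le_abscissa assms(6) by blast
  have feasible: "\<forall>\<^sub>F d in sequentially. feasible n m p d (w d)"
    and near: "\<forall>\<^sub>F d in sequentially. rho n m p d - 1 / real d \<le> box_integral (w d)"
    using assms(6) by (auto simp: eventually_sequentially)
  show "(\<lambda>d. \<integral>\<^sup>+ q\<in>Qbox n. ennreal \<bar>w d q - abscissa m p q\<bar> \<partial>Leb n) \<longlonglongrightarrow> 0"
    using feasible near_optimal_integral_tendsto[OF feasible near lim_1_over_n]
    by (rule L1_tendsto_zero)
qed

end
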